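(* Let $\nu,d,n\in\mathbb{N}$, let $\Psi$ be a real symmetric positive definite $\nu\times\nu$ matrix and $\Sigma$ a real symmetric positive definite $d\times d$ matrix. Let $\mathfrak{X},\mathfrak{X}_1,\dots,\mathfrak{X}_n$ be iid random matrices of size $\nu\times d$ such that $\mathsf{E}[\mathfrak{X}]=0_{\nu\times d}$, $\mathsf{E}[\mathrm{vec}(\mathfrak{X}^\top)\mathrm{vec}(\mathfrak{X}^\top)^\top]=\Psi\otimes\Sigma$, and $\mathsf{E}[|\mathfrak{X}_{ij}|^3]<\infty$ for all $(i,j)\in\{1,\dots,\nu\}\times\{1,\dots,d\}$. Let $\mathfrak{S}=n^{-1/2}\sum_{k=1}^n\mathfrak{X}_k$ and $\mathfrak{Z}\sim\mathcal{N}_{\nu\times d}(0_{\nu\times d},\Psi\otimes\Sigma)$, and denote the laws of $\mathfrak{S}$ and $\mathfrak{Z}$ by $\mu_n$ and $\gamma$, respectively. Then $$d_3(\mu_n,\gamma)\le\frac{1}{3\sqrt n}\sum_{i_1,i_2,i_3=1}^{\nu}\sum_{j_1,j_2,j_3=1}^{d}\Big\{\tfrac12\mathsf{E}[|\mathfrak{X}_{i_1j_1}\mathfrak{X}_{i_2j_2}\mathfrak{X}_{i_3j_3}|]+|\Psi_{i_1i_2}\Sigma_{j_1j_2}|\,\mathsf{E}[|\mathfrak{X}_{i_3j_3}|]\Big\}$$ and $$d_2(\mu_n,\gamma)\le\frac{\sqrt{2\pi}}{4\sqrt n}\ \max_{1\le i\le\nu,\,1\le j\le d}\sqrt{(\Psi^{-1})_{ii}(\Sigma^{-1})_{jj}}\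 \sum_{i_1,i_2,i_3=1}^{\nu}\sum_{j_1,j_2,j_3=1}^{d}\Big\{\tfrac12\mathsf{E}[|\mathfrak{X}_{i_1j_1}\mathfrak{X}_{i_2j_2}\mathfrak{X}_{i_3j_3}|]+|\Psi_{i_1i_2}\Sigma_{j_1j_2}|\,\mathsf{E}[|\mathfrak{X}_{i_3j_3}|]\Big\}.$$
   Context: $\mathrm{vec}$ stacks the columns of a matrix, $\otimes$ is the Kronecker product, and $\mathfrak{N}\sim\mathcal{N}_{\nu\times d}(M,\Psi\otimes\Sigma)$ means $\mathrm{vec}(\mathfrak{N}^\top)\sim\mathcal{N}_{\nu d}(\mathrm{vec}(M^\top),\Psi\otimes\Sigma)$. $\|A\|_F=\sqrt{\mathrm{tr}(A^\top A)}$. For $g:\mathbb{R}^{\nu\times d}\to\mathbb{R}$, $[g]_1=\sup_{X\ne Y}|g(X)-g(Y)|/\|X-Y\|_F$; $\nabla_{ij}=\partial/\partial X_{ij}$. For $p\in\mathbb{N}$ and laws $\mu,\eta$ of $\mathbb{R}^{\nu\times d}$-valued random matrices $\mathfrak{X},\mathfrak{Y}$ with finite $p$th Frobenius-norm moments, the smooth Wasserstein distance is $$d_p(\mu,\eta)=\sup_{h\in\mathcal{H}_p}\big|\mathsf{E}[h(\mathfrak{X})]-\mathsf{E}[h(\mathfrak{Y})]\big|,$$ where $\mathcal{H}_p$ is the set of $h:\mathbb{R}^{\nu\times d}\to\mathbb{R}$ that are $(p-1)$-times differentiable with $\big[\big(\prod_{\ell=1}^{p-1}\nabla_{i_\ell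 j_\ell}\big)h\big]_1\le1$ for all $1\le i_\ell\le\nu$, $1\le j_\ell\le d$. *)

theory Defs
  imports "HOL-Probability.Probability"
begin

text \<open>
  A \<open>\<nu> \<times> d\<close> matrix is an element of \<open>real^'d^'v\<close>, with \<open>(i, j)\<close> entry \<open>X $ i $ j\<close>. The index set of
  \<open>vectorize A\<close> is the set of pairs (column, row); it stands for \<open>{1..n * m}\<close> ordered lexicographically, so
  that \<open>vectorize (transpose X)\<close> and \<open>kronecker \<Psi> \<Sigma>\<close> share the index type \<open>'v \<times> 'd\<close>.
\<close>

definition vectorize :: "real^'n^'m \<Rightarrow> real^('n \<times> 'm)" where
  "vectorize A = (\<chi> p. A $ snd p $ fst p)"

definition kronecker :: "real^'n^'m \<Rightarrow> real^'l^'k \<Rightarrow> real^('n \<times> 'l)^('m \<times> 'k)" where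
  "kronecker A B = (\<chi> p q. A $ fst p $ fst q * B $ snd p $ snd q)"

definition frobenius_norm :: "real^'d^'v \<Rightarrow> real" where
  "frobenius_norm A = sqrt (trace (transpose A ** A))"

lemma frobenius_norm_eq_norm: "frobenius_norm A = norm A"
proof -
  have "trace (transpose A ** A) = (\<Sum>j\<in>UNIV. \<Sum>i\<in>UNIV. A $ i $ j * A $ i $ j)"
    by (simp add: trace_def matrix_matrix_mult_def transpose_def)
  also have "\<dots> = (\<Sum>i\<in>UNIV. \<Sum>j\<in>UNIV. A $ i $ j * A $ i $ j)"
    by (rule sum.swap)
  also have "\<dots> = A \<bullet> A"
    by (simp add: inner_vec_def)
  finally show ?thesis
    by (simp add: frobenius_norm_def norm_eq_sqrt_inner)
qed

definition symmetric_positive_definite :: "real^'n^'n \<Rightarrow> bool" where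
  "symmetric_positive_definite A \<longleftrightarrow> transpose A = A \<and> (\<forall>x. x \<noteq> 0 \<longrightarrow> 0 < x \<bullet> (A *v x))"

definition iid_vars :: "'a measure \<Rightarrow> ('i \<Rightarrow> 'a \<Rightarrow> 'b::topological_space) \<Rightarrow> 'i set \<Rightarrow> bool" where
  "iid_vars P X I \<longleftrightarrow>
     prob_space.indep_vars P (\<lambda>_. borel) X I \<and>
     (\<forall>k\<in>I. \<forall>l\<in>I. distr P borel (X k) = distr P borel (X l))"

text \<open>The density of the multivariate normal law; meaningful only for positive definite \<open>V\<close>.\<close>

definition mvn_density :: "real^'n \<Rightarrow> real^'n^'n \<Rightarrow> real^'n \<Rightarrow> real" where
  "mvn_density m V x =
     exp (- ((x - m) \<bullet> (matrix_inv V *v (x - m))) / 2) / sqrt ((2 * pi) ^ CARD('n) * det V)"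

definition matrix_normal ::
    "'a measure \<Rightarrow> ('a \<Rightarrow> real^'d^'v) \<Rightarrow> real^'d^'v \<Rightarrow> real^('v \<times> 'd)^('v \<times> 'd) \<Rightarrow> bool" where
  "matrix_normal P Z A V \<longleftrightarrow>
     distributed P lborel (\<lambda>\<omega>. vectorize (transpose (Z \<omega>)))
       (\<lambda>x. ennreal (mvn_density (vectorize (transpose A)) V x))"

text \<open>The value is infinite when \<open>g\<close> is not Lipschitz.\<close>

definition lipschitz_seminorm :: "(real^'d^'v \<Rightarrow> real) \<Rightarrow> ereal" where
  "lipschitz_seminorm g =
     (SUP (X, Y)\<in>{(X, Y). X \<noteq> Y}. ereal (\<bar>g X - g Y\<bar> / frobenius_norm (X - Y)))"

definition partial_deriv :: "'v \<Rightarrow> 'd \<Rightarrow> (real^'d^'v \<Rightarrow> real) \<Rightarrow> real^'d^'v \<Rightarrow> real" where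
  "partial_deriv i j h X = deriv (\<lambda>t. h (X + t *\<^sub>R axis i (axis j 1))) 0"

definition iterated_partial_deriv ::
    "('v \<times> 'd) list \<Rightarrow> (real^'d^'v \<Rightarrow> real) \<Rightarrow> real^'d^'v \<Rightarrow> real" where
  "iterated_partial_deriv ijs h = foldr (\<lambda>(i, j). partial_deriv i j) ijs h"

text \<open>
  Iterated Frechet differentiability on the whole space: in finite dimension the derivative map is
  differentiable \<open>k\<close> times iff each of its components, the first-order partial derivatives, is.
\<close>

primrec times_differentiable :: "nat \<Rightarrow> (real^'d^'v \<Rightarrow> real) \<Rightarrow> bool" where
  "times_differentiable 0 h \<longleftrightarrow> True"
| "times_differentiable (Suc k) h \<longleftrightarrow>
     (\<forall>X. h differentiable (at X)) \<and> (\<forall>i j. times_differentiable k (partial_deriv i j h))"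

text \<open>
  For \<open>p \<ge> 1\<close>. A list of \<open>p - 1\<close> index pairs ranges over all mixed partial derivatives of
  order \<open>p - 1\<close>.
\<close>

definition smooth_test_functions :: "nat \<Rightarrow> (real^'d^'v \<Rightarrow> real) set" where
  "smooth_test_functions p =
     {h. times_differentiable (p - 1) h \<and>
         (\<forall>ijs. length ijs = p - 1 \<longrightarrow> lipschitz_seminorm (iterated_partial_deriv ijs h) \<le> 1)}"

text \<open>
  Meant for \<open>p \<ge> 1\<close> and laws on the Borel sets with finite \<open>p\<close>th moments, for which every test function
  is integrable (it grows at most like the \<open>p\<close>th power of the norm). The supremum may be infinite.
\<close>

definition smooth_wasserstein ::
    "nat \<Rightarrow> (real^'d^'v) measure \<Rightarrow> (real^'d^'v) measure \<Rightarrow> ereal" where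
  "smooth_wasserstein p \<mu> \<eta> =
     (SUP h\<in>smooth_test_functions p. ereal \<bar>(\<integral>X. h X \<partial>\<mu>) - (\<integral>X. h X \<partial>\<eta>)\<bar>)"

end

theory Submission
  imports Defs
begin

text \<open>
  Rotate \<open>S\<close> into \<open>Z\<close>: put \<open>\<phi> \<theta> = E h (sin \<theta> S + cos \<theta> Z)\<close> with \<open>Z\<close> independent of \<open>S\<close>, so that
  \<open>\<phi> (pi/2) - \<phi> 0\<close> is the quantity to bound. Conditionally on \<open>S\<close>, Gaussian integration by parts turns
  the \<open>Z\<close>-part of \<open>\<phi>'\<close> into \<open>sin \<theta> cos \<theta> \<Sum> V\<^sub>a\<^sub>b E \<partial>\<^sub>b F\<^sub>a (sin \<theta> S)\<close>, where \<open>F\<^sub>a\<close> is the \<open>a\<close>-th partial derivative of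
  \<open>h\<close> averaged over \<open>cos \<theta> Z\<close>. The \<open>S\<close>-part is \<open>cos \<theta> \<Sum> E S\<^sub>a F\<^sub>a (sin \<theta> S)\<close>; expanding \<open>F\<^sub>a\<close> around
  the sum with the \<open>k\<close>-th summand left out, the terms of order zero vanish, those of order one cancel the
  \<open>Z\<close>-part up to a Lipschitz error, and with \<open>B\<close> the sum in the theorem there remains
  \<open>\<bar>\<phi>'\<bar> \<le> cos \<theta> sin\<^sup>2 \<theta> \<Lambda> B / sqrt n\<close>, where \<open>\<Lambda>\<close> is a Lipschitz constant of the functions \<open>\<partial>\<^sub>b F\<^sub>a\<close>.

  If the second derivatives of \<open>h\<close> are 1-Lipschitz, then \<open>\<Lambda> = 1\<close>, and \<open>cos \<theta> sin\<^sup>2 \<theta>\<close> integrates to \<open>1/3\<close>.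
  If only the first derivatives are, differentiating the Gaussian density instead gives
  \<open>\<Lambda> = E \<bar>(V\<inverse> Z)\<^sub>b\<bar> / cos \<theta> = sqrt (2/pi) sqrt ((V\<inverse>)\<^sub>b\<^sub>b) / cos \<theta>\<close>, and \<open>sin\<^sup>2 \<theta>\<close> integrates to \<open>pi/4\<close>.
\<close>

section \<open>Differentiation under the integral sign and exponential growth bounds\<close>

text \<open>Dominated convergence for the difference quotients along an arbitrary null sequence: by
  the mean value inequality each quotient is at most \<open>w\<close> once the increment is shorter
  than \<open>e\<close>.\<close>

lemma has_real_derivative_integral_dominated:
  fixes f f' :: "real \<Rightarrow> 'a \<Rightarrow> real"
  assumes e: "e > 0"
    and int: "\<And>r. integrable M (f r)"
    and der: "\<And>r x. \<bar>r - t\<bar> < e \<Longrightarrow> x \<in> space M \<Longrightarrow> ((\<lambda>r. f r x) has_real_derivative f' r x) (at r)"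
    and bound: "\<And>r x. \<bar>r - t\<bar> < e \<Longrightarrow> x \<in> space M \<Longrightarrow> \<bar>f' r x\<bar> \<le> w x"
    and w: "integrable M w"
    and meas: "f' t \<in> borel_measurable M"
  shows "((\<lambda>r. \<integral>x. f r x \<partial>M) has_real_derivative (\<integral>x. f' t x \<partial>M)) (at t)"
  unfolding DERIV_def tendsto_at_iff_sequentially comp_def
proof (intro allI impI)
  fix h :: "nat \<Rightarrow> real"
  assume nz: "\<forall>i. h i \<in> UNIV - {0}" and lim: "h \<longlonglongrightarrow> 0"
  \<comment> \<open>Only a tail of \<open>h\<close> stays in the window where \<open>der\<close> and
    \<open>bound\<close> hold. The sequence is therefore shifted by \<open>m\<close>, and
    \<open>LIMSEQ_offset\<close> undoes the shift at the end.\<close>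
  from lim e obtain m where m: "\<And>i. i \<ge> m \<Longrightarrow> \<bar>h i\<bar> < e"
    by (fastforce simp: lim_sequentially)
  have quot: "(\<integral>x. f (t + h i) x \<partial>M) - (\<integral>x. f t x \<partial>M) = (\<integral>x. f (t + h i) x - f t x \<partial>M)" for i
    using int by simp
  have "(\<lambda>i. \<integral>x. (f (t + h (i + m)) x - f t x) / h (i + m) \<partial>M) \<longlonglongrightarrow> (\<integral>x. f' t x \<partial>M)"
  proof (rule integral_dominated_convergence[where w=w])
    show "f' t \<in> borel_measurable M" by fact
    show "(\<lambda>x. (f (t + h (i + m)) x - f t x) / h (i + m)) \<in> borel_measurable M" for i
      using int[THEN borel_measurable_integrable] by measurable
    show "integrable M w" by fact
    show "AE x in M. (\<lambda>i. (f (t + h (i + m)) x - f t x) / h (i + m)) \<longlonglongrightarrow> f' t x"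
    proof (rule AE_I2)
      fix x assume "x \<in> space M"
      then have "((\<lambda>r. f r x) has_real_derivative f' t x) (at t)" using der e by simp
      then have "((\<lambda>h. (f (t + h) x - f t x) / h) \<longlongrightarrow> f' t x) (at 0)"
        by (simp add: DERIV_def)
      then have "(\<lambda>i. (f (t + h i) x - f t x) / h i) \<longlonglongrightarrow> f' t x"
        using nz lim unfolding tendsto_at_iff_sequentially comp_def by blast
      then show "(\<lambda>i. (f (t + h (i + m)) x - f t x) / h (i + m)) \<longlonglongrightarrow> f' t x"
        by (rule LIMSEQ_ignore_initial_segment)
    qed
    show "AE x in M. norm ((f (t + h (i + m)) x - f t x) / h (i + m)) \<le> w x" for i
    proof (rule AE_I2)
      fix x assume x: "x \<in> space M"
      have hi: "\<bar>h (i + m)\<bar> < e" using m[of "i + m"] by simp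
      \<comment> \<open>The interval is symmetric about \<open>t\<close>, so that it contains
        \<open>t + h (i + m)\<close> for either sign of the increment.\<close>
      have "norm (f (t + h (i + m)) x - f t x) \<le> w x * norm (t + h (i + m) - t)"
      proof (rule field_differentiable_bound[where S="{t - \<bar>h (i+m)\<bar>..t + \<bar>h (i+m)\<bar>}" and f'="\<lambda>r. f' r x"])
        show "((\<lambda>r. f r x) has_field_derivative f' z x) (at z within {t - \<bar>h (i+m)\<bar>..t + \<bar>h (i+m)\<bar>})"
          if "z \<in> {t - \<bar>h (i+m)\<bar>..t + \<bar>h (i+m)\<bar>}" for z
        proof -
          have "\<bar>z - t\<bar> < e" using that hi by auto
          then show ?thesis using der x by (auto intro: has_field_derivative_at_within)
        qed
        show "norm (f' z x) \<le> w x" if "z \<in> {t - \<bar>h (i+m)\<bar>..t + \<bar>h (i+m)\<bar>}" for z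
        proof -
          have "\<bar>z - t\<bar> < e" using that hi by auto
          then show ?thesis using bound x by simp
        qed
      qed auto
      then show "norm ((f (t + h (i + m)) x - f t x) / h (i + m)) \<le> w x"
        using nz by (simp add: pos_divide_le_eq norm_divide)
    qed
  qed
  then have "(\<lambda>i. ((\<integral>x. f (t + h (i + m)) x \<partial>M) - (\<integral>x. f t x \<partial>M)) / h (i + m)) \<longlonglongrightarrow> (\<integral>x. f' t x \<partial>M)"
    by (simp add: quot)
  then show "(\<lambda>i. ((\<integral>x. f (t + h i) x \<partial>M) - (\<integral>x. f t x \<partial>M)) / h i) \<longlonglongrightarrow> (\<integral>x. f' t x \<partial>M)"
    by (rule LIMSEQ_offset)
qed

lemma power_le_fact_mult_exp:
  fixes x :: real assumes "0 \<le> x" shows "x ^ k \<le> fact k * exp x"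
proof -
  have s: "(\<lambda>n. x ^ n /\<^sub>R fact n) sums exp x" by (rule exp_converges)
  have "sum (\<lambda>n. x ^ n /\<^sub>R fact n) {k} \<le> exp x"
    unfolding sums_unique[OF s]
    by (rule sum_le_suminf) (use s assms in \<open>auto simp: sums_iff\<close>)
  then show ?thesis by (simp add: field_simps)
qed

text \<open>Trades polynomial growth for the exponential growth in which the Gaussian estimates are
  phrased; \<open>exp 1\<close> comes from moving the argument by one.\<close>

lemma one_plus_power_le_exp:
  fixes x :: real assumes "0 \<le> x" shows "(1 + x) ^ k \<le> fact k * exp 1 * exp x"
  using power_le_fact_mult_exp[of "1 + x" k] assms by (simp add: exp_add mult.assoc)

section \<open>Centred Gaussian measures\<close>

text \<open>
  Neither the value of the normalizing constant \<open>c\<close> nor the covariance of \<open>N\<close> is needed: that \<open>N\<close> has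
  total mass one suffices.
\<close>

locale gaussian_measure = prob_space N for N :: "(real^'n) measure" +
  fixes V W :: "real^'n^'n" and c :: real
  assumes N_eq: "N = density lborel (\<lambda>z. ennreal (c * exp (- (z \<bullet> (W *v z)) / 2)))"
    and c_nonneg: "0 \<le> c"
    and W_sym: "transpose W = W"
    and V_W: "V ** W = mat 1"
begin

lemma sets_N [measurable_cong, simp]: "sets N = sets borel"
  by (simp add: N_eq)

lemma space_N [simp]: "space N = UNIV"
  by (simp add: N_eq)

lemma W_V: "W ** V = mat 1"
  using V_W matrix_left_right_inverse by blast

lemma inner_W_commute: "x \<bullet> (W *v y) = y \<bullet> (W *v x)"
  by (metis W_sym dot_lmul_matrix inner_commute transpose_matrix_vector)

lemma measurable_mult_vec [measurable]: "(\<lambda>z. A *v z) \<in> borel_measurable (borel :: (real^'n) measure)"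
  for A :: "real^'n^'m"
  by (intro borel_measurable_continuous_onI) (auto intro: linear_continuous_on matrix_vector_mul_bounded_linear)

text \<open>A translation by \<open>y\<close> replaces the quadratic form at \<open>z\<close> by the
  one at \<open>z - y\<close>. After expansion the two cross terms merge because \<open>W\<close> is
  symmetric, and the quotient of the two densities is the exponential factor; \<open>c\<close> is
  common to both.\<close>

lemma cameron_martin:
  "distr N borel (\<lambda>z. z + y) = density N (\<lambda>z. ennreal (exp (y \<bullet> (W *v z) - (y \<bullet> (W *v y)) / 2)))"
proof (rule measure_eqI)
  fix A assume "A \<in> sets (distr N borel (\<lambda>z. z + y))"
  then have A[measurable]: "A \<in> sets borel" by simp
  have id: "(z - y) \<bullet> (W *v (z - y)) = z \<bullet> (W *v z) - 2 * (y \<bullet> (W *v z)) + y \<bullet> (W *v y)" for z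
    using inner_W_commute[of z y]
    by (simp add: matrix_vector_mult_diff_distrib inner_diff_left inner_diff_right)
  have "emeasure (distr N borel (\<lambda>z. z + y)) A = (\<integral>\<^sup>+z. indicator A (z + y) \<partial>N)"
    by (subst nn_integral_indicator[symmetric], simp, subst nn_integral_distr) auto
  also have "\<dots> = (\<integral>\<^sup>+z. ennreal (c * exp (- (z \<bullet> (W *v z)) / 2)) * indicator A (z + y) \<partial>lborel)"
    unfolding N_eq by (subst nn_integral_density) auto
  also have "\<dots> = (\<integral>\<^sup>+z. ennreal (c * exp (- ((z - y) \<bullet> (W *v (z - y))) / 2)) * indicator A z \<partial>distr lborel borel ((+) y))"
    by (subst nn_integral_distr) (auto simp: add.commute)
  also have "\<dots> = (\<integral>\<^sup>+z. ennreal (c * exp (- ((z - y) \<bullet> (W *v (z - y))) / 2)) * indicator A z \<partial>lborel)"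
    by (simp add: lborel_distr_plus)
  also have "\<dots> = (\<integral>\<^sup>+z. ennreal (c * exp (- (z \<bullet> (W *v z)) / 2)) *
      (ennreal (exp (y \<bullet> (W *v z) - (y \<bullet> (W *v y)) / 2)) * indicator A z) \<partial>lborel)"
  proof (rule nn_integral_cong)
    fix z
    have "c * exp (- ((z - y) \<bullet> (W *v (z - y))) / 2) =
      c * exp (- (z \<bullet> (W *v z)) / 2) * exp (y \<bullet> (W *v z) - (y \<bullet> (W *v y)) / 2)"
      unfolding id mult.assoc exp_add[symmetric] by (simp add: field_simps)
    then show "ennreal (c * exp (- ((z - y) \<bullet> (W *v (z - y))) / 2)) * indicator A z =
      ennreal (c * exp (- (z \<bullet> (W *v z)) / 2)) * (ennreal (exp (y \<bullet> (W *v z) - (y \<bullet> (W *v y)) / 2)) * indicator A z)"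
      using c_nonneg by (simp only: ennreal_mult mult.assoc exp_ge_zero mult_nonneg_nonneg)
  qed
  also have "\<dots> = (\<integral>\<^sup>+z. ennreal (exp (y \<bullet> (W *v z) - (y \<bullet> (W *v y)) / 2)) * indicator A z \<partial>N)"
    unfolding N_eq by (subst nn_integral_density) auto
  also have "\<dots> = emeasure (density N (\<lambda>z. ennreal (exp (y \<bullet> (W *v z) - (y \<bullet> (W *v y)) / 2)))) A"
    by (subst emeasure_density) (auto simp: measurable_cong_sets[OF sets_N])
  finally show "emeasure (distr N borel (\<lambda>z. z + y)) A = \<dots>" .
qed simp

text \<open>With \<open>y = V *v w\<close> the integrand is a constant times the density in
  \<open>cameron_martin\<close>, and that density has total mass one because it describes a
  translate of a probability measure. Exponential moments thus come without evaluating a Gaussian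
  integral.\<close>

lemma integrable_exp_inner: "integrable N (\<lambda>z. exp (w \<bullet> z))"
proof -
  define y where "y = V *v w"
  have y: "W *v y = w" by (simp add: y_def matrix_vector_mul_assoc W_V)
  have "(\<integral>\<^sup>+z. ennreal (exp (w \<bullet> z - (y \<bullet> (W *v y)) / 2)) \<partial>N) =
    emeasure (density N (\<lambda>z. ennreal (exp (y \<bullet> (W *v z) - (y \<bullet> (W *v y)) / 2)))) UNIV"
    using inner_W_commute[of y] by (simp add: y emeasure_density inner_commute measurable_cong_sets[OF sets_N])
  also have "\<dots> = 1"
    unfolding cameron_martin[symmetric] using emeasure_space_1 by (simp add: emeasure_distr)
  finally have "integrable N (\<lambda>z. exp (w \<bullet> z - (y \<bullet> (W *v y)) / 2))"
    by (intro integrableI_nonneg) (auto simp: measurable_cong_sets[OF sets_N])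
  then have "integrable N (\<lambda>z. exp ((y \<bullet> (W *v y)) / 2) * exp (w \<bullet> z - (y \<bullet> (W *v y)) / 2))"
    by (rule integrable_mult_right)
  then show ?thesis by (simp add: exp_add[symmetric])
qed

lemma integrable_exp_norm: "integrable N (\<lambda>z. exp (r * norm z))"
proof -
  have bnd: "exp (r * norm z) \<le> 1 + (\<Sum>b\<in>UNIV. exp ((axis b (\<bar>r\<bar> * CARD('n))) \<bullet> z) + exp (axis b (- (\<bar>r\<bar> * CARD('n))) \<bullet> z))" (is "_ \<le> 1 + (\<Sum>b\<in>UNIV. ?g b)")
    for z :: "real^'n"
  proof -
    \<comment> \<open>At a coordinate of largest modulus, \<open>norm z\<close> is at most the
      dimension times that modulus. Which coordinate and which sign occur depends on
      \<open>z\<close>, so the majorant sums over all coordinates and both signs.\<close>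
    obtain b where b: "\<bar>z $ b\<bar> = Max (range (\<lambda>b. \<bar>z $ b\<bar>))"
      using Max_in[of "range (\<lambda>b. \<bar>z $ b\<bar>)"] by (metis (mono_tags, lifting) empty_is_image finite finite_imageI image_iff UNIV_not_empty)
    have "norm z \<le> (\<Sum>b\<in>UNIV. \<bar>z $ b\<bar>)" by (rule norm_le_l1_cart)
    also have "\<dots> \<le> (\<Sum>b'\<in>(UNIV::'n set). \<bar>z $ b\<bar>)" unfolding b by (intro sum_mono) auto
    finally have n: "norm z \<le> CARD('n) * \<bar>z $ b\<bar>" by simp
    have "r * norm z \<le> \<bar>r\<bar> * norm z" by (intro mult_right_mono) auto
    also have "\<dots> \<le> \<bar>r\<bar> * (CARD('n) * \<bar>z $ b\<bar>)" by (intro mult_left_mono n) auto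
    finally have "exp (r * norm z) \<le> exp (\<bar>r\<bar> * CARD('n) * \<bar>z $ b\<bar>)" by (simp add: mult.assoc)
    also have "\<dots> \<le> ?g b"
    proof (cases "z $ b \<ge> 0")
      case True
      then show ?thesis by (simp add: inner_axis')
    next
      case False
      then show ?thesis by (simp add: inner_axis')
    qed
    also have "\<dots> \<le> (\<Sum>b\<in>UNIV. ?g b)" by (intro member_le_sum) (auto intro: add_nonneg_nonneg)
    finally show ?thesis by simp
  qed
  show ?thesis
  proof (rule Bochner_Integration.integrable_bound)
    show "integrable N (\<lambda>z. 1 + (\<Sum>b\<in>UNIV. exp ((axis b (\<bar>r\<bar> * CARD('n))) \<bullet> z) + exp (axis b (- (\<bar>r\<bar> * CARD('n))) \<bullet> z)))"
      by (intro Bochner_Integration.integrable_add Bochner_Integration.integrable_sum integrable_exp_inner) simp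
    show "(\<lambda>z. exp (r * norm z)) \<in> borel_measurable N" by measurable
    show "AE z in N. norm (exp (r * norm z)) \<le> norm (1 + (\<Sum>b\<in>UNIV. exp ((axis b (\<bar>r\<bar> * CARD('n))) \<bullet> z) + exp (axis b (- (\<bar>r\<bar> * CARD('n))) \<bullet> z)))"
      using order_trans[OF bnd abs_ge_self] by (auto intro!: AE_I2)
  qed
qed

lemma integrable_power_norm: "integrable N (\<lambda>z. norm z ^ k)"
proof (rule Bochner_Integration.integrable_bound)
  show "integrable N (\<lambda>z. fact k * exp (1 * norm z) :: real)"
    by (intro integrable_mult_right integrable_exp_norm)
  show "(\<lambda>z. norm z ^ k) \<in> borel_measurable N" by measurable
qed (auto intro!: AE_I2 power_le_fact_mult_exp)

text \<open>
  Averaging the Cameron--Martin identity along \<open>\<real> y\<close> against Lebesgue measure turns the translated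
  side into a Lebesgue integral and the density side into a Gaussian integral.
\<close>

lemma nn_integral_one_dim:
  fixes g :: "real \<Rightarrow> ennreal"
  assumes [measurable]: "g \<in> borel_measurable borel"
    and pos: "0 < y \<bullet> (W *v y)"
  shows "(\<integral>\<^sup>+z. g (y \<bullet> (W *v z)) \<partial>N) = (\<integral>\<^sup>+x. g x * normal_density 0 (sqrt (y \<bullet> (W *v y))) x \<partial>lborel)"
proof -
  define v where "v = y \<bullet> (W *v y)"
  note [simp] = v_def[symmetric]
  have v: "v > 0" using pos by simp
  \<comment> \<open>The normal density of variance \<open>v\<close> without its constant. Its
    integral against \<open>g\<close> does not involve \<open>z\<close>, so it may be averaged over
    \<open>N\<close>, of mass one; for each \<open>z\<close> the substitution
    \<open>x = y \<bullet> (W *v z) + v * r\<close> then introduces \<open>z\<close>.\<close>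
  let ?e = "\<lambda>x::real. exp (- x\<^sup>2 / (2 * v))"
  interpret P: pair_sigma_finite N "lborel :: real measure" ..
  have "(\<integral>\<^sup>+x. g x * ?e x \<partial>lborel) = (\<integral>\<^sup>+z. (\<integral>\<^sup>+x. g x * ?e x \<partial>lborel) \<partial>N)"
    using emeasure_space_1 by simp
  also have "\<dots> = (\<integral>\<^sup>+z. (\<integral>\<^sup>+r. g (y \<bullet> (W *v z) + v * r) * ?e (y \<bullet> (W *v z) + v * r) * v \<partial>lborel) \<partial>N)"
  proof (rule nn_integral_cong)
    fix z
    show "(\<integral>\<^sup>+x. g x * ?e x \<partial>lborel) = (\<integral>\<^sup>+r. g (y \<bullet> (W *v z) + v * r) * ?e (y \<bullet> (W *v z) + v * r) * v \<partial>lborel)"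
      using v by (subst nn_integral_real_affine[where c=v and t="y \<bullet> (W *v z)"])
        (auto simp: nn_integral_cmult[symmetric] mult_ac)
  qed
  also have "\<dots> = (\<integral>\<^sup>+r. (\<integral>\<^sup>+z. g (y \<bullet> (W *v z) + v * r) * ?e (y \<bullet> (W *v z) + v * r) * v \<partial>N) \<partial>lborel)"
    by (rule P.Fubini'[symmetric]) measurable
  \<comment> \<open>The argument \<open>y \<bullet> (W *v z) + v * r\<close> is the functional at
    \<open>z + r *\<^sub>R y\<close>, so the inner integral is one over a translate of
    \<open>N\<close> and \<open>cameron_martin\<close> applies.\<close>
  also have "\<dots> = (\<integral>\<^sup>+r. (\<integral>\<^sup>+z. g (y \<bullet> (W *v z)) * ?e (y \<bullet> (W *v z)) * v * exp (r * (y \<bullet> (W *v z)) - r\<^sup>2 * v / 2) \<partial>N) \<partial>lborel)"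
  proof (rule nn_integral_cong)
    fix r
    have "(\<integral>\<^sup>+z. g (y \<bullet> (W *v z) + v * r) * ?e (y \<bullet> (W *v z) + v * r) * v \<partial>N) =
      (\<integral>\<^sup>+z. g (y \<bullet> (W *v z)) * ?e (y \<bullet> (W *v z)) * v \<partial>distr N borel (\<lambda>z. z + r *\<^sub>R y))"
      by (subst nn_integral_distr)
        (auto simp: matrix_vector_right_distrib inner_add_right matrix_vector_mult_scaleR mult_ac)
    also have "\<dots> = (\<integral>\<^sup>+z. exp (r * (y \<bullet> (W *v z)) - r\<^sup>2 * v / 2) * (g (y \<bullet> (W *v z)) * ?e (y \<bullet> (W *v z)) * v) \<partial>N)"
      unfolding cameron_martin
      by (subst nn_integral_density) (auto simp: matrix_vector_mult_scaleR power2_eq_square mult_ac)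
    finally show "(\<integral>\<^sup>+z. g (y \<bullet> (W *v z) + v * r) * ?e (y \<bullet> (W *v z) + v * r) * v \<partial>N) =
      (\<integral>\<^sup>+z. g (y \<bullet> (W *v z)) * ?e (y \<bullet> (W *v z)) * v * exp (r * (y \<bullet> (W *v z)) - r\<^sup>2 * v / 2) \<partial>N)"
      by (simp add: mult_ac)
  qed
  also have "\<dots> = (\<integral>\<^sup>+z. (\<integral>\<^sup>+r. g (y \<bullet> (W *v z)) * ?e (y \<bullet> (W *v z)) * v * exp (r * (y \<bullet> (W *v z)) - r\<^sup>2 * v / 2) \<partial>lborel) \<partial>N)"
    by (rule P.Fubini') measurable
  also have "\<dots> = (\<integral>\<^sup>+z. g (y \<bullet> (W *v z)) * sqrt (2 * pi * v) \<partial>N)"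
  proof (rule nn_integral_cong)
    fix z
    \<comment> \<open>Completing the square in \<open>r\<close> exhibits a normal density with mean
      \<open>?x / v\<close> and standard deviation \<open>1 / sqrt v\<close>. It integrates to one,
      which leaves the constant \<open>sqrt (2 * pi * v)\<close>.\<close>
    let ?x = "y \<bullet> (W *v z)"
    have e: "?e ?x * v * exp (r * ?x - r\<^sup>2 * v / 2) = sqrt (2 * pi * v) * normal_density (?x / v) (1 / sqrt v) r" for r
    proof -
      have "- ?x\<^sup>2 / (2 * v) + (r * ?x - r\<^sup>2 * v / 2) = - (r - ?x / v)\<^sup>2 / (2 * (1 / sqrt v)\<^sup>2)"
        using v by (simp add: field_simps power2_eq_square power_divide real_sqrt_mult_self)
      then have "?e ?x * exp (r * ?x - r\<^sup>2 * v / 2) = exp (- (r - ?x / v)\<^sup>2 / (2 * (1 / sqrt v)\<^sup>2))"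
        by (simp add: exp_add[symmetric])
      moreover have "sqrt (2 * pi * v) * (1 / sqrt (2 * pi * (1 / sqrt v)\<^sup>2)) = v"
        using v by (simp add: real_sqrt_mult real_sqrt_divide power_divide)
      moreover have "?e ?x * v * exp (r * ?x - r\<^sup>2 * v / 2) = v * (?e ?x * exp (r * ?x - r\<^sup>2 * v / 2))"
        by simp
      ultimately show ?thesis
        unfolding normal_density_def mult.assoc[symmetric] by simp
    qed
    have "(\<integral>\<^sup>+r. g ?x * ?e ?x * v * exp (r * ?x - r\<^sup>2 * v / 2) \<partial>lborel) =
      (\<integral>\<^sup>+r. g ?x * sqrt (2 * pi * v) * normal_density (?x / v) (1 / sqrt v) r \<partial>lborel)"
      using v e by (intro nn_integral_cong) (simp add: mult.assoc ennreal_mult[symmetric])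
    also have "\<dots> = g ?x * sqrt (2 * pi * v)"
    proof -
      have "(\<integral>\<^sup>+r. normal_density (?x / v) (1 / sqrt v) r \<partial>lborel) = 1"
        using v prob_space.emeasure_space_1[OF prob_space_normal_density[of "1 / sqrt v" "?x/v"]]
        by (simp add: emeasure_density)
      then show ?thesis by (subst nn_integral_cmult) auto
    qed
    finally show "(\<integral>\<^sup>+r. g ?x * ?e ?x * v * exp (r * ?x - r\<^sup>2 * v / 2) \<partial>lborel) = g ?x * sqrt (2 * pi * v)" .
  qed
  also have "\<dots> = sqrt (2 * pi * v) * (\<integral>\<^sup>+z. g (y \<bullet> (W *v z)) \<partial>N)"
    by (subst nn_integral_cmult[symmetric]) (auto simp: mult_ac)
  finally have main: "(\<integral>\<^sup>+x. g x * ?e x \<partial>lborel) = sqrt (2 * pi * v) * (\<integral>\<^sup>+z. g (y \<bullet> (W *v z)) \<partial>N)" .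
  have "(\<integral>\<^sup>+z. g (y \<bullet> (W *v z)) \<partial>N) = (1 / sqrt (2 * pi * v)) * (sqrt (2 * pi * v) * (\<integral>\<^sup>+z. g (y \<bullet> (W *v z)) \<partial>N))"
    using v by (simp add: mult.assoc[symmetric] ennreal_mult[symmetric])
  also have "\<dots> = (\<integral>\<^sup>+x. (1 / sqrt (2 * pi * v)) * (g x * ?e x) \<partial>lborel)"
    unfolding main[symmetric] by (rule nn_integral_cmult[symmetric]) measurable
  also have "\<dots> = (\<integral>\<^sup>+x. g x * normal_density 0 (sqrt v) x \<partial>lborel)"
    using v by (intro nn_integral_cong) (simp add: normal_density_def ennreal_mult[symmetric] mult_ac)
  finally show ?thesis by simp
qed

text \<open>Under \<open>N\<close> the functional is centred normal with variance
  \<open>y \<bullet> (W *v y)\<close>. Its first absolute moment is the source of the factor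
  \<open>sqrt (2 / pi)\<close> in the second bound.\<close>

lemma expectation_abs_inner:
  assumes pos: "0 < y \<bullet> (W *v y)"
  shows "(\<integral>z. \<bar>y \<bullet> (W *v z)\<bar> \<partial>N) = sqrt (2 / pi) * sqrt (y \<bullet> (W *v y))"
proof -
  let ?s = "sqrt (y \<bullet> (W *v y))"
  have bi: "has_bochner_integral lborel (\<lambda>x. normal_density 0 ?s x * \<bar>x\<bar>) (sqrt (2 / pi) * ?s)"
    using pos normal_moment_abs_odd[where \<sigma>="?s" and \<mu>=0 and k=0] by (simp add: mult.commute[of ?s])
  have "(\<integral>\<^sup>+z. ennreal \<bar>y \<bullet> (W *v z)\<bar> \<partial>N) = (\<integral>\<^sup>+x. ennreal \<bar>x\<bar> * normal_density 0 ?s x \<partial>lborel)"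
    by (rule nn_integral_one_dim[OF _ pos]) measurable
  also have "\<dots> = (\<integral>\<^sup>+x. ennreal (normal_density 0 ?s x * \<bar>x\<bar>) \<partial>lborel)"
    by (simp add: ennreal_mult mult.commute)
  also have "\<dots> = ennreal (sqrt (2 / pi) * ?s)"
    using bi by (subst nn_integral_eq_integral) (auto simp: has_bochner_integral_iff)
  finally show ?thesis
    using pos by (subst integral_eq_nn_integral) auto
qed

lemma borel_measurable_N [simp]: "borel_measurable N = borel_measurable borel"
  by (rule measurable_cong_sets) auto

lemma integrable_exp_growth:
  assumes "f \<in> borel_measurable borel" and "\<And>z. \<bar>f z\<bar> \<le> K * exp (r * norm z)"
  shows "integrable N f"
proof (rule Bochner_Integration.integrable_bound)
  show "integrable N (\<lambda>z. K * exp (r * norm z))"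
    by (intro integrable_mult_right integrable_exp_norm)
  show "AE z in N. norm (f z) \<le> norm (K * exp (r * norm z))"
    using assms(2) by (auto intro!: AE_I2 order_trans[OF _ abs_ge_self])
qed (use assms in simp)

lemma exp_norm_affine_le:
  fixes x z :: "real^'n"
  shows "0 \<le> s \<Longrightarrow> exp (norm (x + s *\<^sub>R z)) \<le> exp (norm x) * exp (s * norm z)"
  using norm_triangle_ineq[of x "s *\<^sub>R z"] by (simp add: exp_add[symmetric])

lemma abs_inner_W_le: "\<bar>y \<bullet> (W *v z)\<bar> \<le> norm y * onorm ((*v) W) * norm z"
proof -
  have "\<bar>y \<bullet> (W *v z)\<bar> \<le> norm y * norm (W *v z)" by (rule Cauchy_Schwarz_ineq2)
  also have "\<dots> \<le> norm y * (onorm ((*v) W) * norm z)"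
    by (intro mult_left_mono onorm) (auto intro: matrix_vector_mul_bounded_linear)
  finally show ?thesis by (simp add: mult.assoc)
qed

lemma integrable_gaussian_average:
  assumes [measurable]: "f \<in> borel_measurable borel"
    and f: "\<And>x. \<bar>f x\<bar> \<le> C * exp (norm x)" and s: "0 \<le> s"
  shows "integrable N (\<lambda>z. f (x + s *\<^sub>R z))"
    and "integrable N (\<lambda>z. (y \<bullet> (W *v z)) * f (x + s *\<^sub>R z))"
proof -
  have C: "0 \<le> C" using f[of 0] by simp
  have 1: "\<bar>f (x + s *\<^sub>R z)\<bar> \<le> C * exp (norm x) * exp (s * norm z)" for z
    using mult_left_mono[OF exp_norm_affine_le[OF s, of x z] C] f[of "x + s *\<^sub>R z"] by (simp add: mult.assoc)
  show "integrable N (\<lambda>z. f (x + s *\<^sub>R z))"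
    by (rule integrable_exp_growth[OF _ 1]) measurable
  have "\<bar>(y \<bullet> (W *v z)) * f (x + s *\<^sub>R z)\<bar> \<le>
      (norm y * onorm ((*v) W) * C * exp (norm x)) * exp ((1 + s) * norm z)" for z
  proof -
    have o: "0 \<le> onorm ((*v) W)" by (intro onorm_pos_le matrix_vector_mul_bounded_linear)
    \<comment> \<open>The linear factor is absorbed into one more exponential, which raises the rate
      from \<open>s\<close> to \<open>1 + s\<close>.\<close>
    have "norm z \<le> exp (norm z)" using exp_ge_add_one_self[of "norm z"] by linarith
    then have "\<bar>y \<bullet> (W *v z)\<bar> \<le> norm y * onorm ((*v) W) * exp (norm z)"
      using abs_inner_W_le[of y z] o
      by (meson mult_left_mono mult_nonneg_nonneg norm_ge_zero order_trans)
    then have "\<bar>(y \<bullet> (W *v z)) * f (x + s *\<^sub>R z)\<bar> \<le>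
      (norm y * onorm ((*v) W) * exp (norm z)) * (C * exp (norm x) * exp (s * norm z))"
      unfolding abs_mult by (intro mult_mono 1) (use o in auto)
    also have "\<dots> = (norm y * onorm ((*v) W) * C * exp (norm x)) * exp ((1 + s) * norm z)"
      by (simp add: exp_add ring_distribs)
    finally show ?thesis .
  qed
  then show "integrable N (\<lambda>z. (y \<bullet> (W *v z)) * f (x + s *\<^sub>R z))"
    by (rule integrable_exp_growth[rotated]) measurable
qed

text \<open>\<open>f\<close> is merely measurable, so the translation is moved from \<open>f\<close>
  to the measure: by \<open>cameron_martin\<close> the parameter \<open>r\<close> then occurs only
  in a smooth density, and that is what gets differentiated under the integral sign.\<close>

lemma has_derivative_gaussian_average:
  assumes [measurable]: "f \<in> borel_measurable borel"
    and f: "\<And>x. \<bar>f x\<bar> \<le> C * exp (norm x)" and s: "0 < s"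
  shows "((\<lambda>r. \<integral>z. f (x + r *\<^sub>R y + s *\<^sub>R z) \<partial>N) has_real_derivative
           (1 / s) * (\<integral>z. (y \<bullet> (W *v z)) * f (x + s *\<^sub>R z) \<partial>N)) (at 0)"
proof -
  define u where "u = y \<bullet> (W *v y)"
  define b where "b = norm y * onorm ((*v) W) / s"
  \<comment> \<open>The logarithm of the Cameron--Martin density for the shift by
    \<open>(r / s) *\<^sub>R y\<close>, which is what the displacement \<open>r *\<^sub>R y\<close>
    becomes after the factor \<open>s\<close> is taken out.\<close>
  define w where "w r z = r / s * (y \<bullet> (W *v z)) - (r / s)\<^sup>2 * u / 2" for r z
  have C: "0 \<le> C" using f[of 0] by simp
  have b: "0 \<le> b" unfolding b_def using s
    by (intro divide_nonneg_pos mult_nonneg_nonneg onorm_pos_le matrix_vector_mul_bounded_linear) auto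
  have yWz: "\<bar>y \<bullet> (W *v z) / s\<bar> \<le> b * norm z" for z
    using abs_inner_W_le[of y z] s by (simp add: b_def field_simps)
  have w_le: "w r z \<le> \<bar>r\<bar> * b * norm z + (r / s)\<^sup>2 * \<bar>u\<bar> / 2" for r z
  proof -
    have "r / s * (y \<bullet> (W *v z)) \<le> \<bar>r\<bar> * \<bar>y \<bullet> (W *v z) / s\<bar>"
      by (metis abs_ge_self abs_mult times_divide_eq_left times_divide_eq_right)
    also have "\<dots> \<le> \<bar>r\<bar> * (b * norm z)" by (intro mult_left_mono yWz) auto
    moreover have "- ((r / s)\<^sup>2 * u / 2) \<le> (r / s)\<^sup>2 * \<bar>u\<bar> / 2"
      by (metis abs_ge_minus_self abs_mult abs_power2 divide_right_mono minus_divide_left zero_le_numeral)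
    ultimately show ?thesis by (simp add: w_def)
  qed
  have [measurable]: "(\<lambda>z. w r z) \<in> borel_measurable borel" for r
    unfolding w_def by measurable
  have fsz: "\<bar>f (x + s *\<^sub>R z)\<bar> \<le> C * exp (norm x) * exp (s * norm z)" for z
    using mult_left_mono[OF exp_norm_affine_le[of s x z] C] f[of "x + s *\<^sub>R z"] s by (simp add: mult.assoc)
  have eq: "(\<integral>z. f (x + r *\<^sub>R y + s *\<^sub>R z) \<partial>N) = (\<integral>z. exp (w r z) * f (x + s *\<^sub>R z) \<partial>N)" for r
  proof -
    have "(\<integral>z. f (x + r *\<^sub>R y + s *\<^sub>R z) \<partial>N) = (\<integral>z. f (x + s *\<^sub>R z) \<partial>distr N borel (\<lambda>z. z + (r / s) *\<^sub>R y))"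
      using s by (subst integral_distr) (auto simp: algebra_simps)
    also have "\<dots> = (\<integral>z. exp (w r z) * f (x + s *\<^sub>R z) \<partial>N)"
      unfolding cameron_martin w_def u_def
      by (subst integral_density) (auto simp: matrix_vector_mult_scaleR power2_eq_square mult_ac)
    finally show ?thesis .
  qed
  \<comment> \<open>For \<open>\<bar>r\<bar> < 1\<close> the density and the linear factor each cost
    \<open>exp (b * norm z)\<close> and \<open>f\<close> costs \<open>exp (s * norm z)\<close>,
    hence the rate \<open>2 * b + s\<close> of the majorant. At \<open>r = 0\<close> the density is
    one and only the linear factor remains.\<close>
  have "((\<lambda>r. \<integral>z. exp (w r z) * f (x + s *\<^sub>R z) \<partial>N) has_real_derivative
     (\<integral>z. exp (w 0 z) * (y \<bullet> (W *v z) / s - 0 * u / s\<^sup>2) * f (x + s *\<^sub>R z) \<partial>N)) (at 0)"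
  proof (rule has_real_derivative_integral_dominated[where e=1 and
      w="\<lambda>z. (exp (\<bar>u\<bar> / (2 * s\<^sup>2)) * (1 + \<bar>u\<bar> / s\<^sup>2) * (C * exp (norm x))) * exp ((2 * b + s) * norm z)"])
    show "integrable N (\<lambda>z. exp (w r z) * f (x + s *\<^sub>R z))" for r
    proof (rule integrable_exp_growth)
      show "\<bar>exp (w r z) * f (x + s *\<^sub>R z)\<bar> \<le>
          exp ((r / s)\<^sup>2 * \<bar>u\<bar> / 2) * (C * exp (norm x)) * exp ((\<bar>r\<bar> * b + s) * norm z)" for z
      proof -
        have "\<bar>exp (w r z) * f (x + s *\<^sub>R z)\<bar> \<le>
            exp (\<bar>r\<bar> * b * norm z + (r / s)\<^sup>2 * \<bar>u\<bar> / 2) * (C * exp (norm x) * exp (s * norm z))"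
          unfolding abs_mult by (intro mult_mono) (use w_le fsz in auto)
        then show ?thesis by (simp add: exp_add ring_distribs mult_ac)
      qed
    qed measurable
    show "((\<lambda>r. exp (w r z) * f (x + s *\<^sub>R z)) has_real_derivative
        exp (w r z) * (y \<bullet> (W *v z) / s - r * u / s\<^sup>2) * f (x + s *\<^sub>R z)) (at r)" for r z
      unfolding w_def using s
      by (auto intro!: derivative_eq_intros simp: power2_eq_square field_simps)
    show "\<bar>exp (w r z) * (y \<bullet> (W *v z) / s - r * u / s\<^sup>2) * f (x + s *\<^sub>R z)\<bar> \<le>
       (exp (\<bar>u\<bar> / (2 * s\<^sup>2)) * (1 + \<bar>u\<bar> / s\<^sup>2) * (C * exp (norm x))) * exp ((2 * b + s) * norm z)"
      if r: "\<bar>r - 0\<bar> < 1" for r z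
    proof -
      have r1: "\<bar>r\<bar> \<le> 1" "r\<^sup>2 \<le> 1" using r by (auto simp: abs_square_le_1)
      have "w r z \<le> b * norm z + \<bar>u\<bar> / (2 * s\<^sup>2)"
      proof -
        have "\<bar>r\<bar> * b * norm z \<le> 1 * b * norm z" using r1 b by (intro mult_right_mono) auto
        moreover have "(r / s)\<^sup>2 * \<bar>u\<bar> / 2 \<le> \<bar>u\<bar> / (2 * s\<^sup>2)"
        proof -
          have "(r / s)\<^sup>2 * \<bar>u\<bar> / 2 = r\<^sup>2 * (\<bar>u\<bar> / (2 * s\<^sup>2))" by (simp add: power_divide)
          also have "\<dots> \<le> 1 * (\<bar>u\<bar> / (2 * s\<^sup>2))" using r1 by (intro mult_right_mono) auto
          finally show ?thesis by simp
        qed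
        ultimately show ?thesis using w_le[of r z] by simp
      qed
      then have e: "exp (w r z) \<le> exp (b * norm z) * exp (\<bar>u\<bar> / (2 * s\<^sup>2))"
        by (simp add: exp_add[symmetric])
      have "\<bar>y \<bullet> (W *v z) / s - r * u / s\<^sup>2\<bar> \<le> b * norm z + \<bar>u\<bar> / s\<^sup>2"
      proof -
        have "\<bar>r * u / s\<^sup>2\<bar> = \<bar>r\<bar> * (\<bar>u\<bar> / s\<^sup>2)" by (simp add: abs_mult)
        also have "\<dots> \<le> 1 * (\<bar>u\<bar> / s\<^sup>2)" using r1 by (intro mult_right_mono) auto
        finally show ?thesis using yWz[of z] by linarith
      qed
      also have "\<dots> \<le> exp (b * norm z) * (1 + \<bar>u\<bar> / s\<^sup>2)"
      proof -
        have e1: "b * norm z + 1 \<le> exp (b * norm z)" using exp_ge_add_one_self[of "b * norm z"] by linarith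
        have "0 \<le> b * norm z" using b by simp
        then have "1 * (\<bar>u\<bar> / s\<^sup>2) \<le> exp (b * norm z) * (\<bar>u\<bar> / s\<^sup>2)" by (intro mult_right_mono) auto
        then show ?thesis using e1 by (simp add: ring_distribs)
      qed
      finally have p: "\<bar>y \<bullet> (W *v z) / s - r * u / s\<^sup>2\<bar> \<le> exp (b * norm z) * (1 + \<bar>u\<bar> / s\<^sup>2)" .
      have "\<bar>exp (w r z) * (y \<bullet> (W *v z) / s - r * u / s\<^sup>2) * f (x + s *\<^sub>R z)\<bar> \<le>
         (exp (b * norm z) * exp (\<bar>u\<bar> / (2 * s\<^sup>2))) * (exp (b * norm z) * (1 + \<bar>u\<bar> / s\<^sup>2)) * (C * exp (norm x) * exp (s * norm z))"
        unfolding abs_mult by (intro mult_mono p fsz mult_nonneg_nonneg) (use e C in auto)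
      also have "exp ((2 * b + s) * norm z) = exp (b * norm z) * exp (b * norm z) * exp (s * norm z)"
        by (simp add: exp_add[symmetric] ring_distribs)
      ultimately show ?thesis by (simp add: mult_ac)
    qed
    show "integrable N (\<lambda>z. (exp (\<bar>u\<bar> / (2 * s\<^sup>2)) * (1 + \<bar>u\<bar> / s\<^sup>2) * (C * exp (norm x))) * exp ((2 * b + s) * norm z))"
      by (intro integrable_mult_right integrable_exp_norm)
  qed auto
  also have "(\<integral>z. exp (w 0 z) * (y \<bullet> (W *v z) / s - 0 * u / s\<^sup>2) * f (x + s *\<^sub>R z) \<partial>N) =
      (\<integral>z. (1 / s) * ((y \<bullet> (W *v z)) * f (x + s *\<^sub>R z)) \<partial>N)"
    by (simp add: w_def)
  also have "\<dots> = (1 / s) * (\<integral>z. (y \<bullet> (W *v z)) * f (x + s *\<^sub>R z) \<partial>N)"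
    by (rule integral_mult_right_zero)
  finally show ?thesis by (simp add: eq)
qed

text \<open>Since \<open>V ** W = mat 1\<close>, the coordinate \<open>z $ a\<close> is the
  combination of the functionals \<open>axis b 1 \<bullet> (W *v z)\<close> with coefficients
  \<open>V $ a $ b\<close>. Integrals against these functionals are, up to the factor
  \<open>s\<close>, the derivatives found in \<open>has_derivative_gaussian_average\<close>, so this
  is Stein's identity.\<close>

lemma gaussian_integration_by_parts:
  assumes [measurable]: "f \<in> borel_measurable borel"
    and f: "\<And>x. \<bar>f x\<bar> \<le> C * exp (norm x)" and s: "0 \<le> s"
  shows "integrable N (\<lambda>z. z $ a * f (x + s *\<^sub>R z))"
    and "(\<integral>z. z $ a * f (x + s *\<^sub>R z) \<partial>N) =
      (\<Sum>b\<in>UNIV. V $ a $ b * (\<integral>z. (axis b 1 \<bullet> (W *v z)) * f (x + s *\<^sub>R z) \<partial>N))"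
proof -
  have z: "z $ a = (\<Sum>b\<in>UNIV. V $ a $ b * (axis b 1 \<bullet> (W *v z)))" for z
  proof -
    have "z = V *v (W *v z)" by (simp add: matrix_vector_mul_assoc V_W)
    then have "z $ a = (V *v (W *v z)) $ a" by simp
    then show ?thesis by (simp add: matrix_vector_mult_def[of V] inner_axis')
  qed
  have eq: "(\<lambda>z. z $ a * f (x + s *\<^sub>R z)) =
    (\<lambda>z. \<Sum>b\<in>UNIV. V $ a $ b * ((axis b 1 \<bullet> (W *v z)) * f (x + s *\<^sub>R z)))"
    by (subst z) (simp add: sum_distrib_right mult.assoc)
  have int: "integrable N (\<lambda>z. (axis b 1 \<bullet> (W *v z)) * f (x + s *\<^sub>R z))" for b :: 'n
    by (rule integrable_gaussian_average[OF _ f s]) measurable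
  show "integrable N (\<lambda>z. z $ a * f (x + s *\<^sub>R z))"
    unfolding eq using int by auto
  show "(\<integral>z. z $ a * f (x + s *\<^sub>R z) \<partial>N) =
      (\<Sum>b\<in>UNIV. V $ a $ b * (\<integral>z. (axis b 1 \<bullet> (W *v z)) * f (x + s *\<^sub>R z) \<partial>N))"
    unfolding eq using int by simp
qed

end

section \<open>Third moments and a second-order Taylor bound\<close>

lemma add_power3_le:
  fixes a b :: real assumes "0 \<le> a" "0 \<le> b"
  shows "(a + b) ^ 3 \<le> 4 * (a ^ 3 + b ^ 3)"
proof -
  have "4 * (a ^ 3 + b ^ 3) - (a + b) ^ 3 = 3 * (a + b) * (a - b)\<^sup>2"
    by (simp add: power3_eq_cube power2_eq_square algebra_simps)
  moreover have "0 \<le> 3 * (a + b) * (a - b)\<^sup>2" using assms by simp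
  ultimately show ?thesis by linarith
qed

lemma integrable_add_power3:
  fixes f g :: "'a \<Rightarrow> real"
  assumes [measurable]: "f \<in> borel_measurable M" "g \<in> borel_measurable M"
    and "\<And>x. 0 \<le> f x" "\<And>x. 0 \<le> g x"
    and "integrable M (\<lambda>x. f x ^ 3)" "integrable M (\<lambda>x. g x ^ 3)"
  shows "integrable M (\<lambda>x. (f x + g x) ^ 3)"
proof (rule Bochner_Integration.integrable_bound)
  show "integrable M (\<lambda>x. 4 * (f x ^ 3 + g x ^ 3))" using assms by simp
  show "AE x in M. norm ((f x + g x) ^ 3) \<le> norm (4 * (f x ^ 3 + g x ^ 3))"
    using assms add_power3_le by (auto intro!: AE_I2)
qed measurable

lemma (in prob_space) integrable_one_plus_sum_power3:
  fixes f :: "'i \<Rightarrow> 'a \<Rightarrow> real"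
  assumes "finite I" and "\<And>i. i \<in> I \<Longrightarrow> f i \<in> borel_measurable M"
    and "\<And>i x. 0 \<le> f i x" and "\<And>i. i \<in> I \<Longrightarrow> integrable M (\<lambda>x. f i x ^ 3)"
  shows "integrable M (\<lambda>x. (1 + (\<Sum>i\<in>I. f i x)) ^ 3)"
  using assms(1,2,4)
proof (induction I)
  case (insert i I)
  have "integrable M (\<lambda>x. (f i x + (1 + (\<Sum>i\<in>I. f i x))) ^ 3)"
    using insert.prems by (intro integrable_add_power3 insert.IH add_nonneg_nonneg sum_nonneg assms(3)) auto
  then show ?case using insert.hyps by (simp add: add.left_commute)
qed simp

text \<open>On the segment from \<open>x\<close> to \<open>x + y\<close> the remainder has a
  derivative of size at most \<open>K * r\<close>, so comparison with
  \<open>K / 2 * r\<^sup>2\<close> bounds it. The norm is expanded into coordinates because one more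
  coordinate factor then produces mixed absolute third moments.\<close>

lemma second_order_taylor_bound:
  fixes F :: "real^'n \<Rightarrow> real" and G :: "'n \<Rightarrow> real^'n \<Rightarrow> real"
  assumes der: "\<And>x y. ((\<lambda>r. F (x + r *\<^sub>R y)) has_real_derivative (\<Sum>b\<in>UNIV. y $ b * G b x)) (at 0)"
    and lip: "\<And>b x x'. \<bar>G b x - G b x'\<bar> \<le> L * norm (x - x')"
  shows "\<bar>F (x + y) - F x - (\<Sum>b\<in>UNIV. y $ b * G b x)\<bar> \<le> L / 2 * (\<Sum>b\<in>UNIV. \<Sum>c\<in>UNIV. \<bar>y $ b * y $ c\<bar>)"
proof -
  \<comment> \<open>A Lipschitz increment of each \<open>G b\<close> over the distance
    \<open>r * norm y\<close>, weighted by the coefficients of \<open>y\<close>, adds up to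
    \<open>K * r\<close>.\<close>
  define K where "K = L * norm y * (\<Sum>b\<in>UNIV. \<bar>y $ b\<bar>)"
  have L: "0 \<le> L" using lip[of undefined 0 "axis undefined 1"] by (simp add: order_trans[OF abs_ge_zero])
  define q where "q r = F (x + r *\<^sub>R y) - r * (\<Sum>b\<in>UNIV. y $ b * G b x)" for r
  define q' where "q' r = (\<Sum>b\<in>UNIV. y $ b * G b (x + r *\<^sub>R y)) - (\<Sum>b\<in>UNIV. y $ b * G b x)" for r
  have der_q: "(q has_real_derivative q' r) (at r)" for r
  proof -
    have "((\<lambda>h. F (x + r *\<^sub>R y + h *\<^sub>R y)) has_real_derivative (\<Sum>b\<in>UNIV. y $ b * G b (x + r *\<^sub>R y))) (at 0)"
      by (rule der)
    then have "((\<lambda>h. F (x + (h + r) *\<^sub>R y)) has_real_derivative (\<Sum>b\<in>UNIV. y $ b * G b (x + r *\<^sub>R y))) (at 0)"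
      by (simp add: scaleR_left_distrib add_ac)
    then have "((\<lambda>h. F (x + h *\<^sub>R y)) has_real_derivative (\<Sum>b\<in>UNIV. y $ b * G b (x + r *\<^sub>R y))) (at r)"
      using DERIV_shift[of "\<lambda>h. F (x + h *\<^sub>R y)" _ 0 r] by simp
    then show ?thesis unfolding q_def q'_def by (auto intro!: derivative_eq_intros)
  qed
  have q'_le: "\<bar>q' r\<bar> \<le> K * r" if "0 \<le> r" for r
  proof -
    have "\<bar>q' r\<bar> = \<bar>\<Sum>b\<in>UNIV. y $ b * (G b (x + r *\<^sub>R y) - G b x)\<bar>"
      by (simp add: q'_def sum_subtractf right_diff_distrib)
    also have "\<dots> \<le> (\<Sum>b\<in>UNIV. \<bar>y $ b\<bar> * (L * (r * norm y)))"
      using lip[of _ "x + r *\<^sub>R y" x] that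
      by (intro order_trans[OF sum_abs] sum_mono) (auto simp: abs_mult intro!: mult_left_mono)
    also have "\<dots> = K * r" by (simp add: K_def sum_distrib_left mult_ac)
    finally show ?thesis .
  qed
  \<comment> \<open>Monotonicity of \<open>q\<close> minus and plus the parabola replaces
    integration of \<open>q'\<close>.\<close>
  have "q 1 - K / 2 * 1\<^sup>2 \<le> q 0 - K / 2 * 0\<^sup>2"
  proof (rule DERIV_nonpos_imp_nonincreasing[where f="\<lambda>r. q r - K / 2 * r\<^sup>2"])
    fix r :: real assume "0 \<le> r" "r \<le> 1"
    then show "\<exists>y. ((\<lambda>r. q r - K / 2 * r\<^sup>2) has_real_derivative y) (at r) \<and> y \<le> 0"
      using q'_le[of r] by (intro exI[of _ "q' r - K * r"]) (auto intro!: derivative_eq_intros der_q)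
  qed simp
  moreover have "q 0 + K / 2 * 0\<^sup>2 \<le> q 1 + K / 2 * 1\<^sup>2"
  proof (rule DERIV_nonneg_imp_nondecreasing[where f="\<lambda>r. q r + K / 2 * r\<^sup>2"])
    fix r :: real assume "0 \<le> r" "r \<le> 1"
    then show "\<exists>y. ((\<lambda>r. q r + K / 2 * r\<^sup>2) has_real_derivative y) (at r) \<and> 0 \<le> y"
      using q'_le[of r] by (intro exI[of _ "q' r + K * r"]) (auto intro!: derivative_eq_intros der_q)
  qed simp
  ultimately have "\<bar>q 1 - q 0\<bar> \<le> K / 2"
    unfolding one_power2 zero_power2 by linarith
  moreover have "K \<le> L * (\<Sum>b\<in>UNIV. \<Sum>c\<in>UNIV. \<bar>y $ b * y $ c\<bar>)"
  proof -
    have "norm y * (\<Sum>b\<in>UNIV. \<bar>y $ b\<bar>) \<le> (\<Sum>b\<in>UNIV. \<bar>y $ b\<bar>) * (\<Sum>b\<in>UNIV. \<bar>y $ b\<bar>)"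
      by (intro mult_right_mono norm_le_l1_cart sum_nonneg) auto
    also have "\<dots> = (\<Sum>b\<in>UNIV. \<Sum>c\<in>UNIV. \<bar>y $ b * y $ c\<bar>)"
      by (simp add: sum_product abs_mult)
    finally show ?thesis unfolding K_def mult.assoc by (rule mult_left_mono[OF _ L])
  qed
  ultimately show ?thesis by (simp add: q_def algebra_simps)
qed

section \<open>Normalized sums of independent vectors\<close>

text \<open>\<open>X 0\<close> is the generic copy, in whose moments the bound is expressed; the
  summands are the copies with indices 1 to \<open>n\<close>.\<close>

locale iid_sample = prob_space P for P :: "'a measure" +
  fixes X :: "nat \<Rightarrow> 'a \<Rightarrow> real^'n" and n :: nat and V :: "real^'n^'n"
  assumes n: "1 \<le> n"
    and indep: "indep_vars (\<lambda>_. borel) X {0..n}"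
    and ident: "\<And>k. k \<le> n \<Longrightarrow> distr P borel (X k) = distr P borel (X 0)"
    and moment3: "integrable P (\<lambda>\<omega>. norm (X 0 \<omega>) ^ 3)"
    and mean: "\<And>a. (\<integral>\<omega>. X 0 \<omega> $ a \<partial>P) = 0"
    and covariance: "\<And>a b. (\<integral>\<omega>. X 0 \<omega> $ a * X 0 \<omega> $ b \<partial>P) = V $ a $ b"
begin

definition S :: "'a \<Rightarrow> real^'n" where
  "S \<omega> = (1 / sqrt (real n)) *\<^sub>R (\<Sum>k=1..n. X k \<omega>)"

definition bound_sum :: real where
  "bound_sum = (\<Sum>a\<in>UNIV. \<Sum>b\<in>UNIV. \<Sum>c\<in>UNIV.
     1 / 2 * (\<integral>\<omega>. \<bar>X 0 \<omega> $ a * X 0 \<omega> $ b * X 0 \<omega> $ c\<bar> \<partial>P) + \<bar>V $ a $ b\<bar> * (\<integral>\<omega>. \<bar>X 0 \<omega> $ c\<bar> \<partial>P))"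

lemma random_variable_X: "k \<le> n \<Longrightarrow> X k \<in> borel_measurable P"
  using indep by (auto simp: indep_vars_def)

lemma random_variable_X_nth [measurable (raw)]: "k \<le> n \<Longrightarrow> (\<lambda>\<omega>. X k \<omega> $ a) \<in> borel_measurable P"
  by (rule measurable_compose[OF random_variable_X])
    (auto intro!: borel_measurable_continuous_onI continuous_intros)

lemma random_variable_norm_X [measurable (raw)]: "k \<le> n \<Longrightarrow> (\<lambda>\<omega>. norm (X k \<omega>)) \<in> borel_measurable P"
  by (rule measurable_compose[OF random_variable_X borel_measurable_norm])

lemma random_variable_sum_X: "I \<subseteq> {0..n} \<Longrightarrow> (\<lambda>\<omega>. \<Sum>k\<in>I. X k \<omega>) \<in> borel_measurable P"
  by (intro borel_measurable_sum random_variable_X) auto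

lemma random_variable_S [measurable]: "S \<in> borel_measurable P"
  unfolding S_def by (intro borel_measurable_scaleR random_variable_sum_X borel_measurable_const) auto

lemma expectation_X:
  fixes g :: "real^'n \<Rightarrow> real"
  assumes "k \<le> n" "g \<in> borel_measurable borel"
  shows "(\<integral>\<omega>. g (X k \<omega>) \<partial>P) = (\<integral>\<omega>. g (X 0 \<omega>) \<partial>P)"
  using assms random_variable_X[of k] random_variable_X[of 0] ident[OF assms(1)]
  by (metis integral_distr le0)

lemma integrable_X:
  fixes g :: "real^'n \<Rightarrow> real"
  assumes "k \<le> n" "g \<in> borel_measurable borel" "integrable P (\<lambda>\<omega>. g (X 0 \<omega>))"
  shows "integrable P (\<lambda>\<omega>. g (X k \<omega>))"
  using assms random_variable_X[of k] random_variable_X[of 0] ident[OF assms(1)]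
  by (metis integrable_distr_eq le0)

text \<open>One random variable with finite third moment that controls every coordinate of every
  copy and, up to a factor, every scaled partial sum. The summand 1 makes its lower powers at most
  its cube, so integrability reduces to counting degrees up to three.\<close>

definition envelope :: "'a \<Rightarrow> real" where
  "envelope \<omega> = 1 + (\<Sum>k=0..n. norm (X k \<omega>))"

lemma envelope_ge_1: "1 \<le> envelope \<omega>"
  by (simp add: envelope_def sum_nonneg)

lemma envelope_measurable [measurable]: "envelope \<in> borel_measurable P"
  unfolding envelope_def
  by (intro borel_measurable_add borel_measurable_sum borel_measurable_const random_variable_norm_X) auto

lemma integrable_envelope: "integrable P (\<lambda>\<omega>. envelope \<omega> ^ 3)"
  unfolding envelope_def
  by (rule integrable_one_plus_sum_power3)
    (auto intro!: integrable_X[where g="\<lambda>x. norm x ^ 3"] moment3 random_variable_norm_X)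

lemma integrable_envelope_bound:
  fixes f :: "'a \<Rightarrow> real"
  assumes "f \<in> borel_measurable P" and "\<And>\<omega>. \<bar>f \<omega>\<bar> \<le> K * envelope \<omega> ^ 3"
  shows "integrable P f"
proof (rule Bochner_Integration.integrable_bound)
  show "integrable P (\<lambda>\<omega>. K * envelope \<omega> ^ 3)" by (intro integrable_mult_right integrable_envelope)
  show "AE \<omega> in P. norm (f \<omega>) \<le> norm (K * envelope \<omega> ^ 3)"
    using assms(2) by (auto intro!: AE_I2 order_trans[OF _ abs_ge_self])
qed fact

lemma envelope_power_le: "j \<le> 3 \<Longrightarrow> envelope \<omega> ^ j \<le> envelope \<omega> ^ 3"
  using envelope_ge_1 by (rule power_increasing[rotated])

lemma X_le_envelope: "k \<le> n \<Longrightarrow> \<bar>X k \<omega> $ a\<bar> \<le> envelope \<omega>"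
proof -
  assume "k \<le> n"
  then have "norm (X k \<omega>) \<le> (\<Sum>k=0..n. norm (X k \<omega>))" by (intro member_le_sum) auto
  then show ?thesis using component_le_norm_cart[of "X k \<omega>" a] by (simp add: envelope_def)
qed

lemma one_plus_norm_sum_le_envelope:
  assumes "I \<subseteq> {0..n}" "0 \<le> t"
  shows "1 + norm (t *\<^sub>R (\<Sum>k\<in>I. X k \<omega>)) \<le> (1 + t) * envelope \<omega>"
proof -
  have "norm (\<Sum>k\<in>I. X k \<omega>) \<le> (\<Sum>k=0..n. norm (X k \<omega>))"
    using assms by (intro order_trans[OF norm_sum] sum_mono2) auto
  then have "t * norm (\<Sum>k\<in>I. X k \<omega>) \<le> t * (\<Sum>k=0..n. norm (X k \<omega>))"
    using assms by (intro mult_left_mono)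
  then show ?thesis using assms by (simp add: envelope_def algebra_simps add_increasing sum_nonneg)
qed

lemma integrable_abs_X: "k \<le> n \<Longrightarrow> integrable P (\<lambda>\<omega>. \<bar>X k \<omega> $ a\<bar>)"
  using order_trans[OF X_le_envelope envelope_power_le[of 1, simplified]]
  by (intro integrable_envelope_bound[where K=1]) auto

lemma abs_X_mult_le:
  assumes "k \<le> n" "\<bar>x\<bar> \<le> K * envelope \<omega> ^ 2"
  shows "\<bar>X k \<omega> $ a * x\<bar> \<le> K * envelope \<omega> ^ 3"
proof -
  have "\<bar>X k \<omega> $ a * x\<bar> \<le> envelope \<omega> * (K * envelope \<omega> ^ 2)"
    unfolding abs_mult using assms envelope_ge_1[of \<omega>] by (intro mult_mono X_le_envelope) auto
  then show ?thesis by (simp add: power2_eq_square power3_eq_cube mult_ac)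
qed

lemma integrable_X_mult:
  assumes "k \<le> n" "f \<in> borel_measurable P" "\<And>\<omega>. \<bar>f \<omega>\<bar> \<le> K * envelope \<omega> ^ 2"
  shows "integrable P (\<lambda>\<omega>. X k \<omega> $ a * f \<omega>)"
  using abs_X_mult_le[OF assms(1,3)] assms(1,2)
  by (intro integrable_envelope_bound[where K=K] borel_measurable_times random_variable_X_nth) auto

lemma XX_le_envelope: "k \<le> n \<Longrightarrow> \<bar>X k \<omega> $ a * X k \<omega> $ b\<bar> \<le> 1 * envelope \<omega> ^ 2"
  unfolding abs_mult power2_eq_square mult_1 using envelope_ge_1[of \<omega>]
  by (intro mult_mono X_le_envelope) auto

lemma integrable_X_X: "k \<le> n \<Longrightarrow> integrable P (\<lambda>\<omega>. X k \<omega> $ a * X k \<omega> $ b)"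
  using order_trans[OF XX_le_envelope] envelope_power_le[of 2]
  by (intro integrable_envelope_bound[where K=1]) auto

lemma integrable_X_X_X: "k \<le> n \<Longrightarrow> integrable P (\<lambda>\<omega>. \<bar>X k \<omega> $ a * X k \<omega> $ b * X k \<omega> $ c\<bar>)"
  using integrable_abs[OF integrable_X_mult[of k "\<lambda>\<omega>. X k \<omega> $ b * X k \<omega> $ c" 1 a]] XX_le_envelope
  by (simp add: mult.assoc)

text \<open>The singleton of \<open>k\<close> and the index set \<open>I\<close> are disjoint blocks
  of an independent family, and the two variables are functions of the respective blocks.\<close>

lemma indep_var_leave_one_out:
  assumes k: "k \<le> n" and I: "I \<subseteq> {0..n} - {k}"
    and f: "f \<in> borel_measurable borel" and g: "g \<in> borel_measurable borel"
  shows "indep_var (borel :: real measure) (\<lambda>\<omega>. f (X k \<omega>)) (borel :: real measure) (\<lambda>\<omega>. g (t *\<^sub>R (\<Sum>l\<in>I. X l \<omega>)))"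
proof -
  have "indep_var (PiM {k} (\<lambda>_. borel)) (\<lambda>\<omega>. restrict (\<lambda>i. X i \<omega>) {k}) (PiM I (\<lambda>_. borel)) (\<lambda>\<omega>. restrict (\<lambda>i. X i \<omega>) I)"
    using k I by (intro indep_var_restrict[OF indep]) auto
  then have "indep_var borel ((\<lambda>x. f (x k)) \<circ> (\<lambda>\<omega>. restrict (\<lambda>i. X i \<omega>) {k}))
     borel ((\<lambda>x. g (t *\<^sub>R (\<Sum>l\<in>I. x l))) \<circ> (\<lambda>\<omega>. restrict (\<lambda>i. X i \<omega>) I))"
    by (rule indep_var_compose) (use f g k in measurable)
  then show ?thesis by (simp add: comp_def cong: sum.cong)
qed


text \<open>With \<open>U\<close> the scaled sum without the \<open>k\<close>-th summand,
  \<open>F a\<close> is expanded at \<open>U\<close>, which is independent of \<open>X k\<close>.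
  The order-zero term vanishes by centring, and the first-order term factors through the covariance.
  The two errors allowed are the Taylor remainder and the cost of evaluating \<open>G\<close> at
  \<open>T\<close> instead of \<open>U\<close>.\<close>

lemma leave_one_out_step:
  fixes F :: "'n \<Rightarrow> real^'n \<Rightarrow> real" and G :: "'n \<Rightarrow> 'n \<Rightarrow> real^'n \<Rightarrow> real"
  assumes k: "k \<in> {1..n}"
    and F_meas [measurable]: "\<And>a. F a \<in> borel_measurable borel"
    and F_bound: "\<And>a x. \<bar>F a x\<bar> \<le> C * (1 + norm x) ^ 2"
    and der: "\<And>a x y. ((\<lambda>r. F a (x + r *\<^sub>R y)) has_real_derivative (\<Sum>b\<in>UNIV. y $ b * G a b x)) (at 0)"
    and lip: "\<And>a b x x'. \<bar>G a b x - G a b x'\<bar> \<le> L * norm (x - x')"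
    and t: "0 \<le> t"
  defines "T \<equiv> \<lambda>\<omega>. t *\<^sub>R (\<Sum>l=1..n. X l \<omega>)"
  shows "integrable P (\<lambda>\<omega>. X k \<omega> $ a * F a (T \<omega>))"
    and "\<bar>(\<integral>\<omega>. X k \<omega> $ a * F a (T \<omega>) \<partial>P) - t * (\<Sum>b\<in>UNIV. V $ a $ b * (\<integral>\<omega>. G a b (T \<omega>) \<partial>P))\<bar> \<le>
      L * t\<^sup>2 * (\<Sum>b\<in>UNIV. \<Sum>c\<in>UNIV. 1 / 2 * (\<integral>\<omega>. \<bar>X 0 \<omega> $ a * X 0 \<omega> $ b * X 0 \<omega> $ c\<bar> \<partial>P)) +
      L * t\<^sup>2 * (\<Sum>b\<in>UNIV. \<Sum>c\<in>UNIV. \<bar>V $ a $ b\<bar> * (\<integral>\<omega>. \<bar>X 0 \<omega> $ c\<bar> \<partial>P))"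
proof -
  define U where "U \<omega> = t *\<^sub>R (\<Sum>l\<in>{1..n} - {k}. X l \<omega>)" for \<omega>
  have kn: "k \<le> n" using k by simp
  have L: "0 \<le> L" using lip[of undefined undefined 0 "axis undefined 1"] by (simp add: order_trans[OF abs_ge_zero])
  have C: "0 \<le> C" using order_trans[OF abs_ge_zero F_bound[of undefined 0]] by simp
  have G_meas [measurable]: "G a b \<in> borel_measurable borel" for a b
  proof -
    have "L-lipschitz_on UNIV (G a b)"
      using lip L by (auto intro!: lipschitz_onI simp: dist_norm)
    then show ?thesis by (intro borel_measurable_continuous_onI lipschitz_on_continuous_on)
  qed
  have T_eq: "T \<omega> = U \<omega> + t *\<^sub>R X k \<omega>" for \<omega>
    unfolding T_def U_def using k by (simp add: sum.remove scaleR_add_right[symmetric] add.commute)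
  have T_meas [measurable]: "T \<in> borel_measurable P"
    unfolding T_def by (intro borel_measurable_scaleR random_variable_sum_X) auto
  have U_meas [measurable]: "U \<in> borel_measurable P"
    unfolding U_def by (intro borel_measurable_scaleR random_variable_sum_X) auto
  have T_env: "1 + norm (T \<omega>) \<le> (1 + t) * envelope \<omega>" for \<omega>
    unfolding T_def by (rule one_plus_norm_sum_le_envelope) (use t in auto)
  have U_env: "1 + norm (U \<omega>) \<le> (1 + t) * envelope \<omega>" for \<omega>
    unfolding U_def by (rule one_plus_norm_sum_le_envelope) (use t in auto)
  have F_env: "\<bar>F a x\<bar> \<le> C * (1 + t)\<^sup>2 * envelope \<omega> ^ 2" if "1 + norm x \<le> (1 + t) * envelope \<omega>" for a x \<omega>
  proof -
    have "(1 + norm x)\<^sup>2 \<le> ((1 + t) * envelope \<omega>)\<^sup>2" using that by (intro power_mono) auto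
    then show ?thesis using F_bound[of a x] C
      by (metis mult.assoc mult_left_mono order_trans power_mult_distrib)
  qed
  have G_env: "\<bar>G a b x\<bar> \<le> (\<bar>G a b 0\<bar> + L) * (1 + t) * envelope \<omega> ^ 1" if "1 + norm x \<le> (1 + t) * envelope \<omega>" for a b x \<omega>
  proof -
    have "\<bar>G a b x\<bar> \<le> \<bar>G a b 0\<bar> + L * norm x" using lip[of a b x 0] by simp
    also have "\<dots> \<le> (\<bar>G a b 0\<bar> + L) * (1 + norm x)" using L by (simp add: algebra_simps)
    also have "\<dots> \<le> (\<bar>G a b 0\<bar> + L) * ((1 + t) * envelope \<omega>)" using that L by (intro mult_left_mono) auto
    finally show ?thesis by (simp add: mult.assoc)
  qed
  have G_env3: "\<bar>G a b x\<bar> \<le> (\<bar>G a b 0\<bar> + L) * (1 + t) * envelope \<omega> ^ 3" if "1 + norm x \<le> (1 + t) * envelope \<omega>" for a b x \<omega>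
    by (rule order_trans[OF G_env[OF that] mult_left_mono[OF envelope_power_le]]) (use L t in auto)
  have int_GT: "integrable P (\<lambda>\<omega>. G a b (T \<omega>))" for a b
    using G_env3[OF T_env] by (rule integrable_envelope_bound[rotated]) measurable
  have int_GU: "integrable P (\<lambda>\<omega>. G a b (U \<omega>))" for a b
    using G_env3[OF U_env] by (rule integrable_envelope_bound[rotated]) measurable
  have int_FU: "integrable P (\<lambda>\<omega>. F a (U \<omega>))" for a
    by (rule integrable_envelope_bound[where K="C * (1 + t)\<^sup>2"], measurable,
      rule order_trans[OF F_env[OF U_env] mult_left_mono[OF envelope_power_le]]) (use C in auto)
  have int_XFU: "integrable P (\<lambda>\<omega>. X k \<omega> $ a * F a (U \<omega>))" for a
    using F_env[OF U_env] by (rule integrable_X_mult[OF kn, rotated]) measurable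
  show int_XFT: "integrable P (\<lambda>\<omega>. X k \<omega> $ a * F a (T \<omega>))"
    using F_env[OF T_env] by (rule integrable_X_mult[OF kn, rotated]) measurable
  have int_X: "integrable P (\<lambda>\<omega>. X k \<omega> $ a)" for a
    using integrable_abs_X[OF kn, of a] kn by (subst (asm) integrable_abs_iff) auto
  have comp: "(\<lambda>x::real^'n. x $ a) \<in> borel_measurable borel" for a
    by (intro borel_measurable_continuous_onI continuous_intros)
  note [measurable] = comp
  have ind_F: "indep_var borel (\<lambda>\<omega>. X k \<omega> $ a) borel (\<lambda>\<omega>. F a (U \<omega>))" for a
    unfolding U_def by (rule indep_var_leave_one_out[OF kn]) auto
  have ind_G: "indep_var borel (\<lambda>\<omega>. X k \<omega> $ a * X k \<omega> $ b) borel (\<lambda>\<omega>. G a b (U \<omega>))" for a b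
    unfolding U_def by (rule indep_var_leave_one_out[OF kn, where f="\<lambda>x. x $ a * x $ b"]) auto
  have "(\<integral>\<omega>. X k \<omega> $ a \<partial>P) = 0"
    using expectation_X[OF kn comp] mean by simp
  then have E_F: "(\<integral>\<omega>. X k \<omega> $ a * F a (U \<omega>) \<partial>P) = 0"
    using indep_var_lebesgue_integral[OF ind_F int_X int_FU] by simp
  have "(\<integral>\<omega>. X k \<omega> $ a * X k \<omega> $ b \<partial>P) = V $ a $ b" for b
    using expectation_X[OF kn, of "\<lambda>x. x $ a * x $ b"] covariance by simp
  then have E_G: "(\<integral>\<omega>. X k \<omega> $ a * X k \<omega> $ b * G a b (U \<omega>) \<partial>P) = V $ a $ b * (\<integral>\<omega>. G a b (U \<omega>) \<partial>P)" for b
    using indep_var_lebesgue_integral[OF ind_G integrable_X_X[OF kn] int_GU] by simp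
  have int_XXG: "integrable P (\<lambda>\<omega>. X k \<omega> $ a * X k \<omega> $ b * G a b (U \<omega>))" for b
    by (rule indep_var_integrable[OF ind_G integrable_X_X[OF kn] int_GU])
  \<comment> \<open>The Taylor remainder of \<open>F a\<close> at \<open>U\<close> for the increment
    \<open>t *\<^sub>R X k\<close>. It is quadratic in that increment, so \<open>t\<^sup>2\<close>
    comes out, and the factor \<open>X k \<omega> $ a\<close> completes the triple products.\<close>
  define R where "R \<omega> = F a (T \<omega>) - F a (U \<omega>) - t * (\<Sum>b\<in>UNIV. X k \<omega> $ b * G a b (U \<omega>))" for \<omega>
  have R_le: "\<bar>X k \<omega> $ a * R \<omega>\<bar> \<le> L * t\<^sup>2 * (\<Sum>b\<in>UNIV. \<Sum>c\<in>UNIV. 1 / 2 * \<bar>X k \<omega> $ a * X k \<omega> $ b * X k \<omega> $ c\<bar>)" for \<omega>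
  proof -
    have "\<bar>R \<omega>\<bar> \<le> L / 2 * (\<Sum>b\<in>UNIV. \<Sum>c\<in>UNIV. \<bar>(t *\<^sub>R X k \<omega>) $ b * (t *\<^sub>R X k \<omega>) $ c\<bar>)"
      using second_order_taylor_bound[OF der lip, of a "U \<omega>" "t *\<^sub>R X k \<omega>"]
      by (simp add: R_def T_eq sum_distrib_left mult.assoc)
    also have "\<dots> = L * t\<^sup>2 * (\<Sum>b\<in>UNIV. \<Sum>c\<in>UNIV. 1 / 2 * \<bar>X k \<omega> $ b * X k \<omega> $ c\<bar>)"
      by (simp add: sum_distrib_left abs_mult power2_eq_square mult_ac t)
    finally have "\<bar>X k \<omega> $ a\<bar> * \<bar>R \<omega>\<bar> \<le> \<bar>X k \<omega> $ a\<bar> * (L * t\<^sup>2 * (\<Sum>b\<in>UNIV. \<Sum>c\<in>UNIV. 1 / 2 * \<bar>X k \<omega> $ b * X k \<omega> $ c\<bar>))"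
      by (rule mult_left_mono) simp
    then show ?thesis by (simp add: sum_distrib_left abs_mult mult_ac)
  qed
  have XR: "(\<lambda>\<omega>. X k \<omega> $ a * R \<omega>) = (\<lambda>\<omega>. X k \<omega> $ a * F a (T \<omega>) - X k \<omega> $ a * F a (U \<omega>) -
      t * (\<Sum>b\<in>UNIV. X k \<omega> $ a * X k \<omega> $ b * G a b (U \<omega>)))"
    by (simp add: R_def right_diff_distrib sum_distrib_left mult_ac)
  have int_XR: "integrable P (\<lambda>\<omega>. X k \<omega> $ a * R \<omega>)"
    unfolding XR using int_XFT int_XFU int_XXG by auto
  have "(\<integral>\<omega>. X k \<omega> $ a * R \<omega> \<partial>P) = (\<integral>\<omega>. X k \<omega> $ a * F a (T \<omega>) \<partial>P) - t * (\<Sum>b\<in>UNIV. V $ a $ b * (\<integral>\<omega>. G a b (U \<omega>) \<partial>P))"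
    unfolding XR using int_XFT int_XFU int_XXG E_F E_G by simp
  \<comment> \<open>The expansion produces \<open>G\<close> at \<open>U\<close>, the claim has
    \<open>G\<close> at \<open>T\<close>; the difference is split off as the second error.\<close>
  then have E_R: "(\<integral>\<omega>. X k \<omega> $ a * F a (T \<omega>) \<partial>P) - t * (\<Sum>b\<in>UNIV. V $ a $ b * (\<integral>\<omega>. G a b (T \<omega>) \<partial>P)) =
      (\<integral>\<omega>. X k \<omega> $ a * R \<omega> \<partial>P) - t * (\<Sum>b\<in>UNIV. V $ a $ b * (\<integral>\<omega>. G a b (T \<omega>) - G a b (U \<omega>) \<partial>P))"
    using int_GT int_GU by (simp add: right_diff_distrib sum_subtractf)
  have int_XXX: "integrable P (\<lambda>\<omega>. \<bar>X k \<omega> $ a * X k \<omega> $ b * X k \<omega> $ c\<bar>)" for b c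
    by (rule integrable_X_X_X[OF kn])
  have "\<bar>\<integral>\<omega>. X k \<omega> $ a * R \<omega> \<partial>P\<bar> \<le> (\<integral>\<omega>. \<bar>X k \<omega> $ a * R \<omega>\<bar> \<partial>P)"
    by (rule integral_abs_bound)
  also have "\<dots> \<le> (\<integral>\<omega>. L * t\<^sup>2 * (\<Sum>b\<in>UNIV. \<Sum>c\<in>UNIV. 1 / 2 * \<bar>X k \<omega> $ a * X k \<omega> $ b * X k \<omega> $ c\<bar>) \<partial>P)"
    by (intro integral_mono integrable_abs[OF int_XR] R_le integrable_mult_right Bochner_Integration.integrable_sum int_XXX)
  also have "\<dots> = L * t\<^sup>2 * (\<Sum>b\<in>UNIV. \<Sum>c\<in>UNIV. 1 / 2 * (\<integral>\<omega>. \<bar>X k \<omega> $ a * X k \<omega> $ b * X k \<omega> $ c\<bar> \<partial>P))"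
    using int_XXX by simp
  also have "\<dots> = L * t\<^sup>2 * (\<Sum>b\<in>UNIV. \<Sum>c\<in>UNIV. 1 / 2 * (\<integral>\<omega>. \<bar>X 0 \<omega> $ a * X 0 \<omega> $ b * X 0 \<omega> $ c\<bar> \<partial>P))"
    using expectation_X[OF kn, of "\<lambda>x. \<bar>x $ a * x $ _ * x $ _\<bar>"] by simp
  finally have 1: "\<bar>\<integral>\<omega>. X k \<omega> $ a * R \<omega> \<partial>P\<bar> \<le> L * t\<^sup>2 * (\<Sum>b\<in>UNIV. \<Sum>c\<in>UNIV. 1 / 2 * (\<integral>\<omega>. \<bar>X 0 \<omega> $ a * X 0 \<omega> $ b * X 0 \<omega> $ c\<bar> \<partial>P))" .
  \<comment> \<open>\<open>T\<close> and \<open>U\<close> differ by \<open>t *\<^sub>R X k\<close>,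
    so the Lipschitz bound costs a first absolute moment. Together with the prefactor
    \<open>t\<close> this error is of order \<open>t\<^sup>2\<close> as well.\<close>
  have dG: "\<bar>\<integral>\<omega>. G a b (T \<omega>) - G a b (U \<omega>) \<partial>P\<bar> \<le> L * t * (\<Sum>c\<in>UNIV. (\<integral>\<omega>. \<bar>X 0 \<omega> $ c\<bar> \<partial>P))" for b
  proof -
    have "\<bar>\<integral>\<omega>. G a b (T \<omega>) - G a b (U \<omega>) \<partial>P\<bar> \<le> (\<integral>\<omega>. \<bar>G a b (T \<omega>) - G a b (U \<omega>)\<bar> \<partial>P)"
      by (rule integral_abs_bound)
    also have "\<dots> \<le> (\<integral>\<omega>. L * t * (\<Sum>c\<in>UNIV. \<bar>X k \<omega> $ c\<bar>) \<partial>P)"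
    proof (rule integral_mono)
      fix \<omega>
      have "\<bar>G a b (T \<omega>) - G a b (U \<omega>)\<bar> \<le> L * t * norm (X k \<omega>)"
        using lip[of a b "T \<omega>" "U \<omega>"] t by (simp add: T_eq mult.assoc)
      also have "\<dots> \<le> L * t * (\<Sum>c\<in>UNIV. \<bar>X k \<omega> $ c\<bar>)"
        using L t by (intro mult_left_mono norm_le_l1_cart) auto
      finally show "\<bar>G a b (T \<omega>) - G a b (U \<omega>)\<bar> \<le> L * t * (\<Sum>c\<in>UNIV. \<bar>X k \<omega> $ c\<bar>)" .
    qed (use int_GT int_GU integrable_abs_X[OF kn] in auto)
    also have "\<dots> = L * t * (\<Sum>c\<in>UNIV. (\<integral>\<omega>. \<bar>X k \<omega> $ c\<bar> \<partial>P))"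
      using integrable_abs_X[OF kn] by simp
    also have "\<dots> = L * t * (\<Sum>c\<in>UNIV. (\<integral>\<omega>. \<bar>X 0 \<omega> $ c\<bar> \<partial>P))"
      using expectation_X[OF kn, of "\<lambda>x. \<bar>x $ _\<bar>"] by simp
    finally show ?thesis .
  qed
  have "\<bar>t * (\<Sum>b\<in>UNIV. V $ a $ b * (\<integral>\<omega>. G a b (T \<omega>) - G a b (U \<omega>) \<partial>P))\<bar> \<le>
      t * (\<Sum>b\<in>UNIV. \<bar>V $ a $ b\<bar> * (L * t * (\<Sum>c\<in>UNIV. (\<integral>\<omega>. \<bar>X 0 \<omega> $ c\<bar> \<partial>P))))"
    unfolding abs_mult abs_of_nonneg[OF t] using t dG
    by (intro mult_left_mono order_trans[OF sum_abs] sum_mono) (auto simp: abs_mult intro!: mult_left_mono)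
  also have "\<dots> = L * t\<^sup>2 * (\<Sum>b\<in>UNIV. \<Sum>c\<in>UNIV. \<bar>V $ a $ b\<bar> * (\<integral>\<omega>. \<bar>X 0 \<omega> $ c\<bar> \<partial>P))"
    by (simp add: sum_distrib_left power2_eq_square mult_ac)
  finally have 2: "\<bar>t * (\<Sum>b\<in>UNIV. V $ a $ b * (\<integral>\<omega>. G a b (T \<omega>) - G a b (U \<omega>) \<partial>P))\<bar> \<le>
    L * t\<^sup>2 * (\<Sum>b\<in>UNIV. \<Sum>c\<in>UNIV. \<bar>V $ a $ b\<bar> * (\<integral>\<omega>. \<bar>X 0 \<omega> $ c\<bar> \<partial>P))" .
  show "\<bar>(\<integral>\<omega>. X k \<omega> $ a * F a (T \<omega>) \<partial>P) - t * (\<Sum>b\<in>UNIV. V $ a $ b * (\<integral>\<omega>. G a b (T \<omega>) \<partial>P))\<bar> \<le>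
      L * t\<^sup>2 * (\<Sum>b\<in>UNIV. \<Sum>c\<in>UNIV. 1 / 2 * (\<integral>\<omega>. \<bar>X 0 \<omega> $ a * X 0 \<omega> $ b * X 0 \<omega> $ c\<bar> \<partial>P)) +
      L * t\<^sup>2 * (\<Sum>b\<in>UNIV. \<Sum>c\<in>UNIV. \<bar>V $ a $ b\<bar> * (\<integral>\<omega>. \<bar>X 0 \<omega> $ c\<bar> \<partial>P))"
    unfolding E_R using 1 2 by linarith
qed

text \<open>Each summand is treated at scale \<open>t = \<tau> / sqrt n\<close>. The
  \<open>n\<close> first-order terms add up exactly to the covariance term, while \<open>n\<close>
  errors of size \<open>t\<^sup>2\<close>, with the outer factor \<open>1 / sqrt n\<close>, leave
  the rate \<open>1 / sqrt n\<close>.\<close>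

lemma leave_one_out:
  fixes F :: "'n \<Rightarrow> real^'n \<Rightarrow> real" and G :: "'n \<Rightarrow> 'n \<Rightarrow> real^'n \<Rightarrow> real"
  assumes F_meas: "\<And>a. F a \<in> borel_measurable borel"
    and F_bound: "\<And>a x. \<bar>F a x\<bar> \<le> C * (1 + norm x) ^ 2"
    and der: "\<And>a x y. ((\<lambda>r. F a (x + r *\<^sub>R y)) has_real_derivative (\<Sum>b\<in>UNIV. y $ b * G a b x)) (at 0)"
    and lip: "\<And>a b x x'. \<bar>G a b x - G a b x'\<bar> \<le> L * norm (x - x')"
    and \<tau>: "0 \<le> \<tau>"
  shows "\<bar>(\<Sum>a\<in>UNIV. (\<integral>\<omega>. S \<omega> $ a * F a (\<tau> *\<^sub>R S \<omega>) \<partial>P)) -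
      \<tau> * (\<Sum>a\<in>UNIV. \<Sum>b\<in>UNIV. V $ a $ b * (\<integral>\<omega>. G a b (\<tau> *\<^sub>R S \<omega>) \<partial>P))\<bar>
    \<le> L * \<tau>\<^sup>2 / sqrt (real n) * bound_sum"
proof -
  define e where "e = 1 / sqrt (real n)"
  define t where "t = \<tau> * e"
  \<comment> \<open>The identity \<open>real n * e\<^sup>2 = 1\<close> does the bookkeeping: it is
    used once for the cancellation in \<open>eq\<close> and once for the error.\<close>
  have e: "0 \<le> e" and ne: "real n * e\<^sup>2 = 1" using n by (auto simp: e_def power_divide)
  have t: "0 \<le> t" using e \<tau> by (simp add: t_def)
  have T: "\<tau> *\<^sub>R S \<omega> = t *\<^sub>R (\<Sum>l=1..n. X l \<omega>)" for \<omega>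
    by (simp add: S_def t_def e_def)
  define A where "A a k = (\<integral>\<omega>. X k \<omega> $ a * F a (\<tau> *\<^sub>R S \<omega>) \<partial>P)" for a k
  define B where "B a = (\<Sum>b\<in>UNIV. V $ a $ b * (\<integral>\<omega>. G a b (\<tau> *\<^sub>R S \<omega>) \<partial>P))" for a
  define D where "D a = (\<Sum>b\<in>UNIV. \<Sum>c\<in>UNIV.
     1 / 2 * (\<integral>\<omega>. \<bar>X 0 \<omega> $ a * X 0 \<omega> $ b * X 0 \<omega> $ c\<bar> \<partial>P) + \<bar>V $ a $ b\<bar> * (\<integral>\<omega>. \<bar>X 0 \<omega> $ c\<bar> \<partial>P))" for a
  note step = leave_one_out_step[where F=F and G=G, OF _ F_meas F_bound der lip t, folded T]
  have A: "\<bar>A a k - t * B a\<bar> \<le> L * t\<^sup>2 * D a" if "k \<in> {1..n}" for a k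
    using step(2)[OF that, of a] by (simp add: A_def B_def D_def sum.distrib distrib_left)
  have SF: "(\<integral>\<omega>. S \<omega> $ a * F a (\<tau> *\<^sub>R S \<omega>) \<partial>P) = e * (\<Sum>k=1..n. A a k)" for a
  proof -
    have "(\<lambda>\<omega>. S \<omega> $ a * F a (\<tau> *\<^sub>R S \<omega>)) = (\<lambda>\<omega>. e * (\<Sum>k=1..n. X k \<omega> $ a * F a (\<tau> *\<^sub>R S \<omega>)))"
      by (rule ext, subst S_def) (simp add: e_def sum_distrib_right)
    then have "(\<integral>\<omega>. S \<omega> $ a * F a (\<tau> *\<^sub>R S \<omega>) \<partial>P) = e * (\<integral>\<omega>. (\<Sum>k=1..n. X k \<omega> $ a * F a (\<tau> *\<^sub>R S \<omega>)) \<partial>P)"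
      by simp
    also have "\<dots> = e * (\<Sum>k=1..n. A a k)"
      unfolding A_def by (subst Bochner_Integration.integral_sum) (use step(1) in auto)
    finally show ?thesis .
  qed
  have eq: "e * (\<Sum>k=1..n. A a k) - \<tau> * B a = e * (\<Sum>k=1..n. A a k - t * B a)" for a
  proof -
    have "e * (\<Sum>k=1..n. A a k - t * B a) = e * (\<Sum>k=1..n. A a k) - (real n * e\<^sup>2) * \<tau> * B a"
      by (simp add: sum_subtractf t_def power2_eq_square algebra_simps)
    then show ?thesis by (simp add: ne)
  qed
  have "\<bar>e * (\<Sum>k=1..n. A a k) - \<tau> * B a\<bar> \<le> L * \<tau>\<^sup>2 * e * D a" for a
  proof -
    have "\<bar>e * (\<Sum>k=1..n. A a k) - \<tau> * B a\<bar> \<le> e * (\<Sum>k=1..n. L * t\<^sup>2 * D a)"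
      unfolding eq abs_mult abs_of_nonneg[OF e]
      by (intro mult_left_mono[OF _ e] order_trans[OF sum_abs] sum_mono A)
    also have "\<dots> = (real n * e\<^sup>2) * (L * \<tau>\<^sup>2 * e * D a)"
      by (simp add: t_def power2_eq_square mult_ac)
    finally show ?thesis by (simp add: ne)
  qed
  then have "\<bar>\<Sum>a\<in>UNIV. (e * (\<Sum>k=1..n. A a k) - \<tau> * B a)\<bar> \<le> (\<Sum>a\<in>UNIV. L * \<tau>\<^sup>2 * e * D a)"
    by (intro order_trans[OF sum_abs] sum_mono)
  also have "\<dots> = L * \<tau>\<^sup>2 * e * (\<Sum>a\<in>UNIV. D a)"
    by (rule sum_distrib_left[symmetric])
  also have "\<dots> = L * \<tau>\<^sup>2 / sqrt (real n) * bound_sum"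
    by (simp add: e_def bound_sum_def D_def)
  finally show ?thesis
    by (simp add: SF B_def sum_subtractf sum_distrib_left)
qed

end

section \<open>Interpolation\<close>

lemma integrable_pair_fst:
  fixes f :: "'a \<Rightarrow> real"
  assumes "prob_space M" "prob_space N" "integrable M f"
  shows "integrable (M \<Otimes>\<^sub>M N) (\<lambda>p. f (fst p))"
proof -
  interpret N: prob_space N by fact
  show ?thesis
    using assms(3) by (intro integrable_distr[OF measurable_fst]) (simp add: N.distr_pair_fst)
qed

lemma integrable_pair_snd:
  fixes f :: "'b \<Rightarrow> real"
  assumes "prob_space M" "prob_space N" "integrable N f"
  shows "integrable (M \<Otimes>\<^sub>M N) (\<lambda>p. f (snd p))"
proof -
  interpret M: prob_space M by fact
  interpret N: prob_space N by fact
  interpret pair_prob_space N M ..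
  show ?thesis
    using integrable_product_swap[OF integrable_pair_fst[OF assms(2,1,3)]]
    by (simp add: case_prod_unfold)
qed

section \<open>Gaussian smoothing and the derivative of the interpolation\<close>

context gaussian_measure begin

definition smoothed :: "real \<Rightarrow> (real^'n \<Rightarrow> real) \<Rightarrow> real^'n \<Rightarrow> real" where
  "smoothed s f x = (\<integral>z. f (x + s *\<^sub>R z) \<partial>N)"

text \<open>For \<open>0 < s\<close> and measurable \<open>f\<close> of exponential growth, the
  \<open>b\<close>-th partial derivative of \<open>smoothed s f\<close>, with the differentiation
  carried by the Gaussian density.\<close>

definition smoothed_deriv :: "real \<Rightarrow> 'n \<Rightarrow> (real^'n \<Rightarrow> real) \<Rightarrow> real^'n \<Rightarrow> real" where
  "smoothed_deriv s b f x = (1 / s) * (\<integral>z. (axis b 1 \<bullet> (W *v z)) * f (x + s *\<^sub>R z) \<partial>N)"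

lemma quadratic_growth_le_exp:
  fixes f :: "real^'n \<Rightarrow> real"
  assumes "\<And>x. \<bar>f x\<bar> \<le> C * (1 + norm x) ^ 2"
  shows "\<bar>f x\<bar> \<le> (C * (2 * exp 1)) * exp (norm x)"
proof -
  have C: "0 \<le> C" using order_trans[OF abs_ge_zero assms[of 0]] by simp
  have "C * (1 + norm x) ^ 2 \<le> C * (fact 2 * exp 1 * exp (norm x))"
    by (rule mult_left_mono[OF one_plus_power_le_exp C]) simp
  then show ?thesis using order_trans[OF assms] by (simp add: mult.assoc)
qed

lemma smoothed_measurable:
  assumes [measurable]: "f \<in> borel_measurable borel"
  shows "smoothed s f \<in> borel_measurable borel"
  unfolding smoothed_def by measurable

text \<open>The weight \<open>1 + norm x\<close> is submultiplicative under addition of vectors, so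
  averaging over a Gaussian displacement preserves quadratic growth, the form that
  \<open>leave_one_out\<close> expects.\<close>

lemma smoothed_growth:
  assumes [measurable]: "f \<in> borel_measurable borel"
    and f: "\<And>x. \<bar>f x\<bar> \<le> C * (1 + norm x) ^ 2" and s: "0 \<le> s"
  shows "\<bar>smoothed s f x\<bar> \<le> (C * (\<integral>z. (1 + s * norm z) ^ 2 \<partial>N)) * (1 + norm x) ^ 2"
proof -
  have C: "0 \<le> C" using order_trans[OF abs_ge_zero f[of 0]] by simp
  have int: "integrable N (\<lambda>z. (1 + s * norm z) ^ 2)"
  proof (rule integrable_exp_growth)
    show "\<bar>(1 + s * norm z)\<^sup>2\<bar> \<le> (fact 2 * exp 1) * exp (s * norm z)" for z :: "real^'n"
      using one_plus_power_le_exp[of "s * norm z" 2] s by simp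
  qed measurable
  have "\<bar>smoothed s f x\<bar> \<le> (\<integral>z. \<bar>f (x + s *\<^sub>R z)\<bar> \<partial>N)"
    unfolding smoothed_def by (rule integral_abs_bound)
  also have "\<dots> \<le> (\<integral>z. (C * (1 + norm x) ^ 2) * (1 + s * norm z) ^ 2 \<partial>N)"
  proof (rule integral_mono)
    fix z :: "real^'n"
    have "norm (x + s *\<^sub>R z) \<le> norm x + s * norm z"
      using norm_triangle_ineq[of x "s *\<^sub>R z"] s by simp
    moreover have "0 \<le> norm x * (s * norm z)" using s by simp
    ultimately have "1 + norm (x + s *\<^sub>R z) \<le> (1 + norm x) * (1 + s * norm z)"
      by (simp add: algebra_simps)
    then have "(1 + norm (x + s *\<^sub>R z))\<^sup>2 \<le> ((1 + norm x) * (1 + s * norm z))\<^sup>2"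
      by (intro power_mono) auto
    then have "C * (1 + norm (x + s *\<^sub>R z))\<^sup>2 \<le> C * ((1 + norm x) * (1 + s * norm z))\<^sup>2"
      by (rule mult_left_mono[OF _ C])
    then show "\<bar>f (x + s *\<^sub>R z)\<bar> \<le> (C * (1 + norm x) ^ 2) * (1 + s * norm z) ^ 2"
      using f[of "x + s *\<^sub>R z"] by (simp add: power_mult_distrib mult.assoc)
  qed (use integrable_gaussian_average(1)[OF assms(1) quadratic_growth_le_exp[OF f] s] int in auto)
  also have "\<dots> = (C * (\<integral>z. (1 + s * norm z) ^ 2 \<partial>N)) * (1 + norm x) ^ 2"
    by (simp add: mult_ac)
  finally show ?thesis .
qed

lemma smoothed_has_derivative:
  assumes [measurable]: "f \<in> borel_measurable borel"
    and f: "\<And>x. \<bar>f x\<bar> \<le> C * exp (norm x)" and s: "0 < s"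
  shows "((\<lambda>r. smoothed s f (x + r *\<^sub>R y)) has_real_derivative
           (\<Sum>b\<in>UNIV. y $ b * smoothed_deriv s b f x)) (at 0)"
proof -
  have y: "y \<bullet> (W *v z) = (\<Sum>b\<in>UNIV. y $ b * (axis b 1 \<bullet> (W *v z)))" for z
    by (simp add: inner_vec_def[of y] inner_axis')
  have "(\<integral>z. (y \<bullet> (W *v z)) * f (x + s *\<^sub>R z) \<partial>N) =
      (\<Sum>b\<in>UNIV. y $ b * (\<integral>z. (axis b 1 \<bullet> (W *v z)) * f (x + s *\<^sub>R z) \<partial>N))"
    unfolding y using integrable_gaussian_average(2)[OF assms(1) f less_imp_le[OF s]]
    by (simp add: sum_distrib_right mult.assoc)
  then show ?thesis
    using has_derivative_gaussian_average[OF assms(1) f s, of x y]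
    by (simp add: smoothed_def smoothed_deriv_def sum_divide_distrib)
qed

lemma integration_by_parts_smoothed:
  assumes "f \<in> borel_measurable borel"
    and "\<And>x. \<bar>f x\<bar> \<le> C * exp (norm x)" and "0 < s"
  shows "(\<integral>z. z $ a * f (x + s *\<^sub>R z) \<partial>N) = s * (\<Sum>b\<in>UNIV. V $ a $ b * smoothed_deriv s b f x)"
  using gaussian_integration_by_parts(2)[OF assms(1,2), of s a x] assms(3)
  by (simp add: smoothed_deriv_def sum_distrib_left)

text \<open>The product measure makes \<open>Y\<close> and the Gaussian vector independent. By
  Fubini the \<open>Y\<close>-part of the derivative becomes an average of smoothed functions, and
  in the other part Stein's identity releases a second factor \<open>cos \<theta>\<close>, so that
  \<open>cos \<theta>\<close> can be taken out of both.\<close>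

lemma interpolation_has_derivative:
  fixes P :: "'a measure" and Y :: "'a \<Rightarrow> real^'n" and h :: "real^'n \<Rightarrow> real" and f :: "'n \<Rightarrow> real^'n \<Rightarrow> real"
  assumes P: "prob_space P" and Y [measurable]: "Y \<in> borel_measurable P"
    and Y3: "integrable P (\<lambda>\<omega>. norm (Y \<omega>) ^ 3)"
    and h: "\<And>x. (h has_derivative (\<lambda>y. \<Sum>a\<in>UNIV. y $ a * f a x)) (at x)"
    and h_bound: "\<And>x. \<bar>h x\<bar> \<le> C * (1 + norm x) ^ 3"
    and f_meas [measurable]: "\<And>a. f a \<in> borel_measurable borel"
    and f_bound: "\<And>a x. \<bar>f a x\<bar> \<le> C * (1 + norm x) ^ 2"
    and s: "0 < cos \<theta>"
  shows "((\<lambda>\<theta>. \<integral>p. h (sin \<theta> *\<^sub>R Y (fst p) + cos \<theta> *\<^sub>R snd p) \<partial>(P \<Otimes>\<^sub>M N)) has_real_derivative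
     cos \<theta> * ((\<Sum>a\<in>UNIV. \<integral>\<omega>. Y \<omega> $ a * smoothed (cos \<theta>) (f a) (sin \<theta> *\<^sub>R Y \<omega>) \<partial>P) -
       sin \<theta> * (\<Sum>a\<in>UNIV. \<Sum>b\<in>UNIV. V $ a $ b * (\<integral>\<omega>. smoothed_deriv (cos \<theta>) b (f a) (sin \<theta> *\<^sub>R Y \<omega>) \<partial>P)))) (at \<theta>)"
    and "continuous_on UNIV (\<lambda>\<theta>. \<integral>p. h (sin \<theta> *\<^sub>R Y (fst p) + cos \<theta> *\<^sub>R snd p) \<partial>(P \<Otimes>\<^sub>M N))"
proof -
  interpret P: prob_space P by fact
  interpret PN: pair_prob_space P N ..
  define U where "U \<theta> p = sin \<theta> *\<^sub>R Y (fst p) + cos \<theta> *\<^sub>R snd p" for \<theta> and p :: "'a \<times> (real^'n)"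
  \<comment> \<open>Sine and cosine are at most one in modulus, so \<open>D\<close> dominates
    \<open>1 + norm (U \<theta> p)\<close> for all angles at once, and its cube is
    integrable.\<close>
  define D where "D p = 1 + norm (Y (fst p)) + norm (snd p)" for p :: "'a \<times> (real^'n)"
  have U_meas [measurable]: "U \<theta> \<in> borel_measurable (P \<Otimes>\<^sub>M N)" for \<theta>
    unfolding U_def by measurable
  have D_ge: "0 \<le> D p" "norm (Y (fst p)) \<le> D p" "norm (snd p) \<le> D p" for p
    by (auto simp: D_def)
  have int_D: "integrable (P \<Otimes>\<^sub>M N) (\<lambda>p. D p ^ 3)"
    unfolding D_def
  proof (intro integrable_add_power3)
    show "integrable (P \<Otimes>\<^sub>M N) (\<lambda>p. norm (Y (fst p)) ^ 3)"
      using integrable_pair_fst[OF P prob_space_axioms Y3] by simp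
    show "integrable (P \<Otimes>\<^sub>M N) (\<lambda>p. norm (snd p) ^ 3)"
      using integrable_pair_snd[OF P prob_space_axioms integrable_power_norm[of 3]] by simp
  qed auto
  have dom: "integrable (P \<Otimes>\<^sub>M N) g"
    if "g \<in> borel_measurable (P \<Otimes>\<^sub>M N)" "\<And>p. \<bar>g p\<bar> \<le> K * D p ^ 3" for g :: "'a \<times> (real^'n) \<Rightarrow> real" and K
  proof (rule Bochner_Integration.integrable_bound)
    show "integrable (P \<Otimes>\<^sub>M N) (\<lambda>p. K * D p ^ 3)" by (intro integrable_mult_right int_D)
    show "AE p in P \<Otimes>\<^sub>M N. norm (g p) \<le> norm (K * D p ^ 3)"
      using that(2) by (auto intro!: AE_I2 order_trans[OF _ abs_ge_self])
  qed fact
  have C: "0 \<le> C" using order_trans[OF abs_ge_zero h_bound[of 0]] by simp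
  have U_le: "1 + norm (U \<theta> p) \<le> D p" for \<theta> p
  proof -
    have "norm (U \<theta> p) \<le> norm (sin \<theta> *\<^sub>R Y (fst p)) + norm (cos \<theta> *\<^sub>R snd p)"
      unfolding U_def by (rule norm_triangle_ineq)
    also have "\<dots> \<le> 1 * norm (Y (fst p)) + 1 * norm (snd p)"
      unfolding norm_scaleR by (intro add_mono mult_right_mono) auto
    finally show ?thesis by (simp add: D_def)
  qed
  have fU: "\<bar>f a (U \<theta> p)\<bar> \<le> C * D p ^ 2" for a \<theta> p
    using f_bound[of a "U \<theta> p"] U_le[of \<theta> p] C
    by (meson add_nonneg_nonneg mult_left_mono norm_ge_zero order_trans power_mono zero_le_one)
  have mult_fU: "\<bar>x * f a (U \<theta> p)\<bar> \<le> (K * C) * D p ^ 3" if "\<bar>x\<bar> \<le> K * D p" "0 \<le> K" for x K a \<theta> p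
  proof -
    have "\<bar>x * f a (U \<theta> p)\<bar> \<le> (K * D p) * (C * D p ^ 2)"
      unfolding abs_mult using that D_ge(1)[of p] by (intro mult_mono fU) auto
    then show ?thesis by (simp add: power2_eq_square power3_eq_cube mult_ac)
  qed
  have Y_le: "\<bar>Y (fst p) $ a\<bar> \<le> 1 * D p" and z_le: "\<bar>snd p $ a\<bar> \<le> 1 * D p" for p a
    using D_ge[of p] component_le_norm_cart[of "Y (fst p)" a] component_le_norm_cart[of "snd p" a] by auto
  have nth_meas [measurable]: "(\<lambda>x::real^'n. x $ a) \<in> borel_measurable borel" for a
    by (intro borel_measurable_continuous_onI continuous_intros)
  have h_meas [measurable]: "h \<in> borel_measurable borel"
    using h by (intro borel_measurable_continuous_onI) (meson continuous_at_imp_continuous_on has_derivative_continuous)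
  have int_h: "integrable (P \<Otimes>\<^sub>M N) (\<lambda>p. h (U \<theta> p))" for \<theta>
  proof (rule dom)
    show "\<bar>h (U \<theta> p)\<bar> \<le> C * D p ^ 3" for p
      using h_bound[of "U \<theta> p"] U_le[of \<theta> p] C
      by (meson add_nonneg_nonneg mult_left_mono norm_ge_zero order_trans power_mono zero_le_one)
  qed measurable
  have int_Yf: "integrable (P \<Otimes>\<^sub>M N) (\<lambda>p. Y (fst p) $ a * f a (U \<theta> p))" for a \<theta>
    using mult_fU[OF Y_le] by (rule dom[rotated]) auto
  have int_zf: "integrable (P \<Otimes>\<^sub>M N) (\<lambda>p. snd p $ a * f a (U \<theta> p))" for a \<theta>
    using mult_fU[OF z_le] by (rule dom[rotated]) auto
  have int_Wf: "integrable (P \<Otimes>\<^sub>M N) (\<lambda>p. (axis b 1 \<bullet> (W *v snd p)) * f a (U \<theta> p))" for a b \<theta>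
  proof (rule dom[OF _ mult_fU])
    show "0 \<le> onorm ((*v) W)" by (intro onorm_pos_le matrix_vector_mul_bounded_linear)
    then show "\<bar>axis b 1 \<bullet> (W *v snd p)\<bar> \<le> onorm ((*v) W) * D p" for p
      using order_trans[OF abs_inner_W_le[of "axis b 1"] mult_left_mono[OF D_ge(3)]] by (simp add: norm_axis_1)
  qed measurable
  define g where "g \<theta> p = (\<Sum>a\<in>UNIV. (cos \<theta> * Y (fst p) $ a - sin \<theta> * snd p $ a) * f a (U \<theta> p))" for \<theta> p
  have g_eq: "g \<theta> = (\<lambda>p. cos \<theta> * (\<Sum>a\<in>UNIV. Y (fst p) $ a * f a (U \<theta> p)) - sin \<theta> * (\<Sum>a\<in>UNIV. snd p $ a * f a (U \<theta> p)))" for \<theta>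
    by (rule ext) (simp add: g_def left_diff_distrib sum_subtractf sum_distrib_left mult.assoc)
  \<comment> \<open>This form of the derivative holds at every angle, which gives the continuity
    claim also at \<open>pi / 2\<close>, where the cosine vanishes. The majorant is uniform in the
    angle.\<close>
  have der: "((\<lambda>\<theta>. \<integral>p. h (U \<theta> p) \<partial>(P \<Otimes>\<^sub>M N)) has_real_derivative (\<integral>p. g \<theta> p \<partial>(P \<Otimes>\<^sub>M N))) (at \<theta>)" for \<theta>
  proof (rule has_real_derivative_integral_dominated[where e=1 and w="\<lambda>p. (\<Sum>a\<in>(UNIV::'n set). (2 * C) * D p ^ 3)"])
    show "((\<lambda>\<theta>. h (U \<theta> p)) has_real_derivative g \<theta> p) (at \<theta>)" for \<theta> p
    proof -
      have "((\<lambda>\<theta>. U \<theta> p) has_derivative (\<lambda>r. r *\<^sub>R (cos \<theta> *\<^sub>R Y (fst p) - sin \<theta> *\<^sub>R snd p))) (at \<theta>)"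
        unfolding U_def by (auto intro!: derivative_eq_intros simp: algebra_simps)
      from has_derivative_compose[OF this h]
      show ?thesis
        unfolding has_field_derivative_def
        by (rule has_derivative_eq_rhs) (simp add: g_def fun_eq_iff sum_distrib_left mult_ac)
    qed
    show "\<bar>g \<theta> p\<bar> \<le> (\<Sum>a\<in>(UNIV::'n set). (2 * C) * D p ^ 3)" for \<theta> p
      unfolding g_def
    proof (intro order_trans[OF sum_abs] sum_mono mult_fU)
      show "\<bar>cos \<theta> * Y (fst p) $ a - sin \<theta> * snd p $ a\<bar> \<le> 2 * D p" for a
      proof -
        have "\<bar>cos \<theta> * Y (fst p) $ a\<bar> \<le> 1 * D p" "\<bar>sin \<theta> * snd p $ a\<bar> \<le> 1 * D p"
          unfolding abs_mult using Y_le[of p a] z_le[of p a] D_ge(1)[of p] by (intro mult_mono; simp)+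
        then show ?thesis by linarith
      qed
    qed simp
    show "integrable (P \<Otimes>\<^sub>M N) (\<lambda>p. \<Sum>a\<in>(UNIV::'n set). (2 * C) * D p ^ 3)"
      using int_D by (intro Bochner_Integration.integrable_sum integrable_mult_right)
    show "g \<theta> \<in> borel_measurable (P \<Otimes>\<^sub>M N)" for \<theta> unfolding g_def by measurable
  qed (use int_h in auto)
  show "continuous_on UNIV (\<lambda>\<theta>. \<integral>p. h (sin \<theta> *\<^sub>R Y (fst p) + cos \<theta> *\<^sub>R snd p) \<partial>(P \<Otimes>\<^sub>M N))"
    using der unfolding U_def by (auto intro!: continuous_at_imp_continuous_on DERIV_isCont)
  have f_exp: "\<bar>f a x\<bar> \<le> (C * (2 * exp 1)) * exp (norm x)" for a x
    by (rule quadratic_growth_le_exp[OF f_bound])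
  have 1: "(\<integral>p. Y (fst p) $ a * f a (U \<theta> p) \<partial>(P \<Otimes>\<^sub>M N)) =
      (\<integral>\<omega>. Y \<omega> $ a * smoothed (cos \<theta>) (f a) (sin \<theta> *\<^sub>R Y \<omega>) \<partial>P)" for a
    unfolding PN.integral_fst'[OF int_Yf, symmetric] by (simp add: U_def smoothed_def)
  have int_G: "integrable P (\<lambda>\<omega>. smoothed_deriv (cos \<theta>) b (f a) (sin \<theta> *\<^sub>R Y \<omega>))" for a b
    using PN.integrable_fst'[OF int_Wf[of b a \<theta>]] by (simp add: smoothed_deriv_def U_def)
  have 2: "(\<integral>p. snd p $ a * f a (U \<theta> p) \<partial>(P \<Otimes>\<^sub>M N)) =
      cos \<theta> * (\<Sum>b\<in>UNIV. V $ a $ b * (\<integral>\<omega>. smoothed_deriv (cos \<theta>) b (f a) (sin \<theta> *\<^sub>R Y \<omega>) \<partial>P))" for a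
  \<comment> \<open>Fubini, then Stein's identity for the inner integral at fixed
    \<open>\<omega>\<close>; here the positivity of \<open>cos \<theta>\<close> enters, as the scale
    of the smoothing.\<close>
  proof -
    have "(\<integral>p. snd p $ a * f a (U \<theta> p) \<partial>(P \<Otimes>\<^sub>M N)) =
        (\<integral>\<omega>. (\<integral>z. z $ a * f a (sin \<theta> *\<^sub>R Y \<omega> + cos \<theta> *\<^sub>R z) \<partial>N) \<partial>P)"
      unfolding PN.integral_fst'[OF int_zf, symmetric] by (simp add: U_def)
    also have "\<dots> = (\<integral>\<omega>. cos \<theta> * (\<Sum>b\<in>UNIV. V $ a $ b * smoothed_deriv (cos \<theta>) b (f a) (sin \<theta> *\<^sub>R Y \<omega>)) \<partial>P)"
      by (subst integration_by_parts_smoothed[OF f_meas f_exp s]) simp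
    also have "\<dots> = cos \<theta> * (\<Sum>b\<in>UNIV. V $ a $ b * (\<integral>\<omega>. smoothed_deriv (cos \<theta>) b (f a) (sin \<theta> *\<^sub>R Y \<omega>) \<partial>P))"
      using int_G by simp
    finally show ?thesis .
  qed
  have "(\<integral>p. g \<theta> p \<partial>(P \<Otimes>\<^sub>M N)) =
    cos \<theta> * (\<Sum>a\<in>UNIV. (\<integral>p. Y (fst p) $ a * f a (U \<theta> p) \<partial>(P \<Otimes>\<^sub>M N))) -
    sin \<theta> * (\<Sum>a\<in>UNIV. (\<integral>p. snd p $ a * f a (U \<theta> p) \<partial>(P \<Otimes>\<^sub>M N)))"
    unfolding g_eq using int_Yf[of _ \<theta>] int_zf[of _ \<theta>] by simp
  also have "\<dots> = cos \<theta> * ((\<Sum>a\<in>UNIV. \<integral>\<omega>. Y \<omega> $ a * smoothed (cos \<theta>) (f a) (sin \<theta> *\<^sub>R Y \<omega>) \<partial>P) -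
       sin \<theta> * (\<Sum>a\<in>UNIV. \<Sum>b\<in>UNIV. V $ a $ b * (\<integral>\<omega>. smoothed_deriv (cos \<theta>) b (f a) (sin \<theta> *\<^sub>R Y \<omega>) \<partial>P)))"
    unfolding 1 2 by (simp add: sum_distrib_left right_diff_distrib mult_ac)
  finally show "((\<lambda>\<theta>. \<integral>p. h (sin \<theta> *\<^sub>R Y (fst p) + cos \<theta> *\<^sub>R snd p) \<partial>(P \<Otimes>\<^sub>M N)) has_real_derivative
     cos \<theta> * ((\<Sum>a\<in>UNIV. \<integral>\<omega>. Y \<omega> $ a * smoothed (cos \<theta>) (f a) (sin \<theta> *\<^sub>R Y \<omega>) \<partial>P) -
       sin \<theta> * (\<Sum>a\<in>UNIV. \<Sum>b\<in>UNIV. V $ a $ b * (\<integral>\<omega>. smoothed_deriv (cos \<theta>) b (f a) (sin \<theta> *\<^sub>R Y \<omega>) \<partial>P)))) (at \<theta>)"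
    using der[of \<theta>] unfolding U_def by simp
qed

text \<open>\<open>\<Lambda> s\<close> is a Lipschitz constant at smoothing scale \<open>s\<close>,
  and \<open>\<psi>\<close> is an antiderivative of the resulting bound. Its derivative is
  prescribed only where the cosine is positive: for \<open>\<Lambda> s = \<kappa> / s\<close> the
  product with the cosine takes the value zero at \<open>pi / 2\<close>, by the convention for
  division by zero.\<close>

lemma interpolation_bound:
  fixes P :: "'a measure" and X :: "nat \<Rightarrow> 'a \<Rightarrow> real^'n" and h :: "real^'n \<Rightarrow> real" and f :: "'n \<Rightarrow> real^'n \<Rightarrow> real"
  assumes "iid_sample P X n V"
    and h: "\<And>x. (h has_derivative (\<lambda>y. \<Sum>a\<in>UNIV. y $ a * f a x)) (at x)"
    and h_bound: "\<And>x. \<bar>h x\<bar> \<le> C * (1 + norm x) ^ 3"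
    and f_meas: "\<And>a. f a \<in> borel_measurable borel"
    and f_bound: "\<And>a x. \<bar>f a x\<bar> \<le> C * (1 + norm x) ^ 2"
    and lip: "\<And>s a b x x'. 0 < s \<Longrightarrow>
      \<bar>smoothed_deriv s b (f a) x - smoothed_deriv s b (f a) x'\<bar> \<le> \<Lambda> s * norm (x - x')"
    and \<psi>: "\<And>\<theta>. (\<psi> has_real_derivative \<psi>' \<theta>) (at \<theta>)"
    and \<psi>': "\<And>\<theta>. 0 < cos \<theta> \<Longrightarrow> \<psi>' \<theta> = cos \<theta> * (sin \<theta>)\<^sup>2 * \<Lambda> (cos \<theta>)"
  shows "\<bar>(\<integral>\<omega>. h (iid_sample.S X n \<omega>) \<partial>P) - (\<integral>z. h z \<partial>N)\<bar> \<le>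
    (\<psi> (pi / 2) - \<psi> 0) / sqrt (real n) * iid_sample.bound_sum P X V"
proof -
  interpret I: iid_sample P X n V by fact
  have h_meas [measurable]: "h \<in> borel_measurable borel"
    using h by (intro borel_measurable_continuous_onI) (meson continuous_at_imp_continuous_on has_derivative_continuous)
  interpret PN: pair_prob_space P N ..
  have S3: "integrable P (\<lambda>\<omega>. norm (I.S \<omega>) ^ 3)"
  proof (rule I.integrable_envelope_bound)
    show "\<bar>norm (I.S \<omega>) ^ 3\<bar> \<le> (1 + 1 / sqrt (real n)) ^ 3 * I.envelope \<omega> ^ 3" for \<omega>
    proof -
      have "1 + norm (I.S \<omega>) \<le> (1 + 1 / sqrt (real n)) * I.envelope \<omega>"
        unfolding I.S_def by (rule I.one_plus_norm_sum_le_envelope) auto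
      then have "norm (I.S \<omega>) ^ 3 \<le> ((1 + 1 / sqrt (real n)) * I.envelope \<omega>) ^ 3"
        by (intro power_mono) auto
      then show ?thesis by (simp add: power_mult_distrib)
    qed
  qed measurable
  define \<phi> where "\<phi> \<theta> = (\<integral>p. h (sin \<theta> *\<^sub>R I.S (fst p) + cos \<theta> *\<^sub>R snd p) \<partial>(P \<Otimes>\<^sub>M N))" for \<theta>
  define \<phi>' where "\<phi>' \<theta> = cos \<theta> * ((\<Sum>a\<in>UNIV. \<integral>\<omega>. I.S \<omega> $ a * smoothed (cos \<theta>) (f a) (sin \<theta> *\<^sub>R I.S \<omega>) \<partial>P) -
       sin \<theta> * (\<Sum>a\<in>UNIV. \<Sum>b\<in>UNIV. V $ a $ b * (\<integral>\<omega>. smoothed_deriv (cos \<theta>) b (f a) (sin \<theta> *\<^sub>R I.S \<omega>) \<partial>P)))" for \<theta>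
  define K where "K = I.bound_sum / sqrt (real n)"
  have der: "(\<phi> has_real_derivative \<phi>' \<theta>) (at \<theta>)" if "0 < cos \<theta>" for \<theta>
    unfolding \<phi>_def \<phi>'_def
    by (rule interpolation_has_derivative(1)[OF I.prob_space_axioms I.random_variable_S S3 h h_bound f_meas f_bound that])
  \<comment> \<open>Instantiated at the angle 0, where the cosine is positive; the continuity
    conclusion covers all angles.\<close>
  have cont: "continuous_on A \<phi>" for A
    unfolding \<phi>_def
    by (rule continuous_on_subset[OF interpolation_has_derivative(2)[OF I.prob_space_axioms I.random_variable_S S3 h h_bound f_meas f_bound, of 0]]) auto
  have contK: "continuous_on A \<psi>" for A
    using \<psi> by (auto intro!: continuous_at_imp_continuous_on DERIV_isCont)
  have bound: "\<bar>\<phi>' \<theta>\<bar> \<le> \<psi>' \<theta> * K" if "0 < \<theta>" "\<theta> < pi / 2" for \<theta>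
  proof -
    have c: "0 < cos \<theta>" using that by (intro cos_gt_zero) auto
    have s: "0 \<le> sin \<theta>" using that by (intro sin_ge_zero) auto
    have "\<bar>(\<Sum>a\<in>UNIV. \<integral>\<omega>. I.S \<omega> $ a * smoothed (cos \<theta>) (f a) (sin \<theta> *\<^sub>R I.S \<omega>) \<partial>P) -
       sin \<theta> * (\<Sum>a\<in>UNIV. \<Sum>b\<in>UNIV. V $ a $ b * (\<integral>\<omega>. smoothed_deriv (cos \<theta>) b (f a) (sin \<theta> *\<^sub>R I.S \<omega>) \<partial>P))\<bar>
       \<le> \<Lambda> (cos \<theta>) * (sin \<theta>)\<^sup>2 / sqrt (real n) * I.bound_sum"
      by (rule I.leave_one_out[where F="\<lambda>a. smoothed (cos \<theta>) (f a)" and G="\<lambda>a b. smoothed_deriv (cos \<theta>) b (f a)",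
            OF smoothed_measurable[OF f_meas] smoothed_growth[OF f_meas f_bound less_imp_le[OF c]]
               smoothed_has_derivative[OF f_meas quadratic_growth_le_exp[OF f_bound] c] lip[OF c] s])
    then have "\<bar>\<phi>' \<theta>\<bar> \<le> cos \<theta> * (\<Lambda> (cos \<theta>) * (sin \<theta>)\<^sup>2 / sqrt (real n) * I.bound_sum)"
      unfolding \<phi>'_def abs_mult abs_of_pos[OF c] using c by (intro mult_left_mono) auto
    then show ?thesis by (simp add: \<psi>'[OF c] K_def mult_ac)
  qed
  \<comment> \<open>Both \<open>\<phi> + \<psi> * K\<close> and \<open>\<psi> * K - \<phi>\<close>
    are nondecreasing, which integrates the derivative bound. Derivatives are taken in the open
    interval only, and continuity reaches the endpoints.\<close>
  have "\<phi> 0 + \<psi> 0 * K \<le> \<phi> (pi / 2) + \<psi> (pi / 2) * K"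
  proof (rule DERIV_nonneg_imp_increasing_open[where f="\<lambda>\<theta>. \<phi> \<theta> + \<psi> \<theta> * K"])
    show "\<exists>y. ((\<lambda>\<theta>. \<phi> \<theta> + \<psi> \<theta> * K) has_real_derivative y) (at \<theta>) \<and> 0 \<le> y" if "0 < \<theta>" "\<theta> < pi / 2" for \<theta>
      using bound[OF that] that
      by (intro exI[of _ "\<phi>' \<theta> + \<psi>' \<theta> * K"]) (auto intro!: derivative_eq_intros der \<psi> cos_gt_zero)
  qed (auto intro!: continuous_intros cont contK)
  moreover have "\<phi> (pi / 2) - \<psi> (pi / 2) * K \<le> \<phi> 0 - \<psi> 0 * K"
  proof -
    have "- (\<phi> 0 - \<psi> 0 * K) \<le> - (\<phi> (pi / 2) - \<psi> (pi / 2) * K)"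
    proof (rule DERIV_nonneg_imp_increasing_open[where f="\<lambda>\<theta>. - (\<phi> \<theta> - \<psi> \<theta> * K)"])
      show "\<exists>y. ((\<lambda>\<theta>. - (\<phi> \<theta> - \<psi> \<theta> * K)) has_real_derivative y) (at \<theta>) \<and> 0 \<le> y" if "0 < \<theta>" "\<theta> < pi / 2" for \<theta>
        using bound[OF that] that
        by (intro exI[of _ "- (\<phi>' \<theta> - \<psi>' \<theta> * K)"]) (auto intro!: derivative_eq_intros der \<psi> cos_gt_zero)
    qed (auto intro!: continuous_intros cont contK)
    then show ?thesis by simp
  qed
  ultimately have "\<bar>\<phi> (pi / 2) - \<phi> 0\<bar> \<le> \<psi> (pi / 2) * K - \<psi> 0 * K" by linarith
  moreover have "\<phi> (pi / 2) = (\<integral>\<omega>. h (I.S \<omega>) \<partial>P)"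
  proof -
    have "(\<integral>p. h (I.S (fst p)) \<partial>(P \<Otimes>\<^sub>M N)) = (\<integral>\<omega>. h (I.S \<omega>) \<partial>distr (P \<Otimes>\<^sub>M N) P fst)"
      by (rule integral_distr[symmetric]) measurable
    then show ?thesis by (simp add: \<phi>_def distr_pair_fst)
  qed
  moreover have "\<phi> 0 = (\<integral>z. h z \<partial>N)"
  proof -
    interpret NP: pair_prob_space N P ..
    have "(\<integral>p. h (snd p) \<partial>(P \<Otimes>\<^sub>M N)) = (\<integral>p. h (fst p) \<partial>(N \<Otimes>\<^sub>M P))"
      using NP.integral_product_swap[of "\<lambda>p. h (fst p)"] by (simp add: case_prod_unfold)
    also have "\<dots> = (\<integral>z. h z \<partial>distr (N \<Otimes>\<^sub>M P) N fst)"
      by (rule integral_distr[symmetric]) measurable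
    finally show ?thesis by (simp add: \<phi>_def I.distr_pair_fst)
  qed
  ultimately show ?thesis by (simp add: K_def left_diff_distrib diff_divide_distrib)
qed

end

section \<open>Growth of test functions and Lipschitz constants of smoothed derivatives\<close>

lemma sum_axis_mult: "(\<Sum>c\<in>UNIV. (axis b (1::real) :: real^'n) $ c * k c) = k b"
  by (simp add: axis_def if_distrib if_distribR cong: if_cong)

text \<open>The mean value inequality on the ray from the origin raises the growth exponent by one.
  Starting from Lipschitz derivatives it supplies the quadratic and cubic bounds that
  \<open>interpolation_bound\<close> asks for.\<close>

lemma growth_of_gradient_growth:
  fixes F :: "real^'n \<Rightarrow> real" and C :: real
  assumes der: "\<And>x. (F has_derivative (\<lambda>y. \<Sum>b\<in>UNIV. y $ b * g b x)) (at x)"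
    and g: "\<And>b x. \<bar>g b x\<bar> \<le> C * (1 + norm x) ^ k"
  shows "\<bar>F x\<bar> \<le> (\<bar>F 0\<bar> + real CARD('n) * C) * (1 + norm x) ^ (k + 1)"
proof -
  define B where "B = real CARD('n) * C * (1 + norm x) ^ k * norm x"
  have C: "0 \<le> C" using order_trans[OF abs_ge_zero g[of undefined 0]] by simp
  have "norm (F x - F 0) \<le> B * norm (1 - 0 :: real)"
  proof -
    have "norm (F (1 *\<^sub>R x) - F (0 *\<^sub>R x)) \<le> B * norm (1 - 0 :: real)"
    proof (rule field_differentiable_bound[where S="{0..1}" and f="\<lambda>r. F (r *\<^sub>R x)"
          and f'="\<lambda>r. \<Sum>b\<in>UNIV. x $ b * g b (r *\<^sub>R x)"])
      fix r :: real assume r: "r \<in> {0..1}"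
      have "((\<lambda>r. r *\<^sub>R x) has_derivative (\<lambda>h. h *\<^sub>R x)) (at r)"
        by (auto intro!: derivative_eq_intros)
      from has_derivative_compose[OF this der]
      have "((\<lambda>r. F (r *\<^sub>R x)) has_field_derivative (\<Sum>b\<in>UNIV. x $ b * g b (r *\<^sub>R x))) (at r)"
        unfolding has_field_derivative_def
        by (rule has_derivative_eq_rhs) (simp add: fun_eq_iff sum_distrib_left mult_ac)
      then show "((\<lambda>r. F (r *\<^sub>R x)) has_field_derivative (\<Sum>b\<in>UNIV. x $ b * g b (r *\<^sub>R x))) (at r within {0..1})"
        by (rule has_field_derivative_at_within)
      have "norm (r *\<^sub>R x) \<le> norm x" using r by (simp add: mult_left_le_one_le)
      then have "\<bar>g b (r *\<^sub>R x)\<bar> \<le> C * (1 + norm x) ^ k" for b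
        using g[of b "r *\<^sub>R x"] C
        by (meson add_left_mono add_nonneg_nonneg mult_left_mono norm_ge_zero order_trans power_mono zero_le_one)
      then have "\<bar>x $ b * g b (r *\<^sub>R x)\<bar> \<le> norm x * (C * (1 + norm x) ^ k)" for b
        unfolding abs_mult by (intro mult_mono component_le_norm_cart) auto
      then have "\<bar>\<Sum>b\<in>UNIV. x $ b * g b (r *\<^sub>R x)\<bar> \<le> (\<Sum>b\<in>(UNIV::'n set). norm x * (C * (1 + norm x) ^ k))"
        by (intro order_trans[OF sum_abs] sum_mono)
      then show "norm (\<Sum>b\<in>UNIV. x $ b * g b (r *\<^sub>R x)) \<le> B" by (simp add: B_def mult_ac)
    qed auto
    then show ?thesis by simp
  qed
  then have "\<bar>F x\<bar> \<le> \<bar>F 0\<bar> * 1 + real CARD('n) * C * ((1 + norm x) ^ k * norm x)" by (simp add: B_def mult_ac)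
  also have "\<dots> \<le> \<bar>F 0\<bar> * (1 + norm x) ^ (k + 1) + real CARD('n) * C * ((1 + norm x) ^ (k + 1))"
  proof (intro add_mono mult_left_mono)
    show "1 \<le> (1 + norm x) ^ (k + 1)" by (rule one_le_power) simp
    have "(1 + norm x) ^ k * norm x \<le> (1 + norm x) ^ k * (1 + norm x)" by (intro mult_left_mono) auto
    then show "(1 + norm x) ^ k * norm x \<le> (1 + norm x) ^ (k + 1)" by (simp add: mult.commute)
  qed (use C in auto)
  finally show ?thesis by (simp add: distrib_right)
qed

lemma lipschitz_linear_growth:
  fixes f :: "real^'n \<Rightarrow> real"
  assumes "\<And>x x'. \<bar>f x - f x'\<bar> \<le> norm (x - x')"
  shows "\<bar>f x\<bar> \<le> (\<bar>f 0\<bar> + 1) * (1 + norm x) ^ 1"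
proof -
  have "\<bar>f x\<bar> \<le> \<bar>f 0\<bar> + norm x" using assms[of x 0] by simp
  also have "\<dots> \<le> (\<bar>f 0\<bar> + 1) * (1 + norm x)" by (simp add: algebra_simps)
  finally show ?thesis by simp
qed

lemma uniform_growth_constant:
  fixes f :: "'n::finite \<Rightarrow> 'b::real_normed_vector \<Rightarrow> real"
  assumes "\<And>a x. \<bar>f a x\<bar> \<le> C a * (1 + norm x) ^ k"
  shows "\<bar>f a x\<bar> \<le> (\<Sum>a\<in>UNIV. \<bar>C a\<bar>) * (1 + norm x) ^ k"
proof -
  have "C a \<le> (\<Sum>a\<in>UNIV. \<bar>C a\<bar>)"
    using member_le_sum[of a UNIV "\<lambda>a. \<bar>C a\<bar>"] by simp
  then show ?thesis by (intro order_trans[OF assms] mult_right_mono) auto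
qed

lemma borel_measurable_lipschitz_real:
  fixes f :: "real^'n \<Rightarrow> real"
  assumes "\<And>x x'. \<bar>f x - f x'\<bar> \<le> norm (x - x')"
  shows "f \<in> borel_measurable borel"
proof -
  have "1-lipschitz_on UNIV f" using assms by (auto intro!: lipschitz_onI simp: dist_norm)
  then show ?thesis by (intro borel_measurable_continuous_onI lipschitz_on_continuous_on)
qed

context gaussian_measure begin

text \<open>As the density carries the derivative, \<open>f\<close> enters only through its
  increments, each at most \<open>norm (x - x')\<close>. What remains is the first absolute moment
  of the functional, of variance \<open>W $ b $ b\<close>, divided by \<open>s\<close>.\<close>

lemma lipschitz_smoothed_deriv:
  assumes f: "\<And>x x'. \<bar>f x - f x'\<bar> \<le> norm (x - x')" and s: "0 < s" and pos: "0 < W $ b $ b"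
  shows "\<bar>smoothed_deriv s b f x - smoothed_deriv s b f x'\<bar> \<le> (sqrt (2 / pi) * sqrt (W $ b $ b) / s) * norm (x - x')"
proof -
  have [measurable]: "f \<in> borel_measurable borel" by (rule borel_measurable_lipschitz_real[OF f])
  have f_exp: "\<bar>f x\<bar> \<le> (\<bar>f 0\<bar> + 1) * exp (norm x)" for x
    by (rule order_trans[OF lipschitz_linear_growth[OF f] mult_left_mono]) (simp_all add: exp_ge_add_one_self)
  have int: "integrable N (\<lambda>z. (axis b 1 \<bullet> (W *v z)) * f (x + s *\<^sub>R z))" for x
    by (rule integrable_gaussian_average(2)[OF _ f_exp less_imp_le[OF s]]) measurable
  have Wb: "axis b 1 \<bullet> (W *v axis b 1) = W $ b $ b"
    by (simp add: inner_axis' matrix_vector_mul_component inner_axis)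
  \<comment> \<open>The case of the constant function one.\<close>
  have int_W: "integrable N (\<lambda>z. \<bar>axis b 1 \<bullet> (W *v z)\<bar>)"
    using integrable_gaussian_average(2)[of "\<lambda>_. 1" 1 s "axis b 1" 0] s by auto
  have "\<bar>(\<integral>z. (axis b 1 \<bullet> (W *v z)) * f (x + s *\<^sub>R z) \<partial>N) - (\<integral>z. (axis b 1 \<bullet> (W *v z)) * f (x' + s *\<^sub>R z) \<partial>N)\<bar> =
    \<bar>\<integral>z. (axis b 1 \<bullet> (W *v z)) * f (x + s *\<^sub>R z) - (axis b 1 \<bullet> (W *v z)) * f (x' + s *\<^sub>R z) \<partial>N\<bar>"
    using int by simp
  also have "\<dots> \<le> (\<integral>z. \<bar>(axis b 1 \<bullet> (W *v z)) * f (x + s *\<^sub>R z) - (axis b 1 \<bullet> (W *v z)) * f (x' + s *\<^sub>R z)\<bar> \<partial>N)"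
    by (rule integral_abs_bound)
  also have "\<dots> \<le> (\<integral>z. \<bar>axis b 1 \<bullet> (W *v z)\<bar> * norm (x - x') \<partial>N)"
  proof (rule integral_mono)
    fix z
    show "\<bar>(axis b 1 \<bullet> (W *v z)) * f (x + s *\<^sub>R z) - (axis b 1 \<bullet> (W *v z)) * f (x' + s *\<^sub>R z)\<bar> \<le>
        \<bar>axis b 1 \<bullet> (W *v z)\<bar> * norm (x - x')"
      unfolding right_diff_distrib[symmetric] abs_mult
      using f[of "x + s *\<^sub>R z" "x' + s *\<^sub>R z"] by (intro mult_left_mono) auto
  qed (use int int_W in auto)
  also have "\<dots> = sqrt (2 / pi) * sqrt (W $ b $ b) * norm (x - x')"
    using expectation_abs_inner[of "axis b 1"] pos by (simp add: Wb)
  finally show ?thesis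
    unfolding smoothed_deriv_def right_diff_distrib[symmetric] abs_mult using s by (simp add: field_simps)
qed

text \<open>
  Passing to the limit in second-order differences, so that \<open>F\<close> need not be differentiated under the
  integral sign a second time.
\<close>

lemma lipschitz_smoothed_deriv_of_gradient:
  assumes F: "\<And>x. (F has_derivative (\<lambda>y. \<Sum>b\<in>UNIV. y $ b * g b x)) (at x)"
    and g: "\<And>b x x'. \<bar>g b x - g b x'\<bar> \<le> norm (x - x')"
    and growth: "\<And>x. \<bar>F x\<bar> \<le> C * exp (norm x)" and s: "0 < s"
  shows "\<bar>smoothed_deriv s b F x - smoothed_deriv s b F x'\<bar> \<le> norm (x - x')"
proof -
  have F_meas [measurable]: "F \<in> borel_measurable borel"
    using F by (intro borel_measurable_continuous_onI) (meson continuous_at_imp_continuous_on has_derivative_continuous)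
  let ?e = "axis b 1 :: real^'n"
  have int: "integrable N (\<lambda>z. F (x + s *\<^sub>R z))" for x
    by (rule integrable_gaussian_average(1)[OF F_meas growth less_imp_le[OF s]])
  \<comment> \<open>The difference of \<open>F\<close> along two parallel lines in direction
    \<open>b\<close> has as derivative a difference of \<open>g b\<close>, which is at most the
    distance of the lines; the mean value inequality does the rest.\<close>
  have increment: "\<bar>(F (u + r *\<^sub>R ?e) - F (u' + r *\<^sub>R ?e)) - (F u - F u')\<bar> \<le> norm (u - u') * \<bar>r\<bar>" for u u' r
  proof -
    have "norm ((F (u + r *\<^sub>R ?e) - F (u' + r *\<^sub>R ?e)) - (F (u + 0 *\<^sub>R ?e) - F (u' + 0 *\<^sub>R ?e))) \<le> norm (u - u') * norm (r - 0)"
    proof (rule field_differentiable_bound[where S=UNIV and f'="\<lambda>r. g b (u + r *\<^sub>R ?e) - g b (u' + r *\<^sub>R ?e)"])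
      fix r
      have "((\<lambda>r. F (u + r *\<^sub>R ?e)) has_field_derivative g b (u + r *\<^sub>R ?e)) (at r)" for u
      proof -
        have "((\<lambda>r. u + r *\<^sub>R ?e) has_derivative (\<lambda>h. h *\<^sub>R ?e)) (at r)"
          by (auto intro!: derivative_eq_intros)
        from has_derivative_compose[OF this F]
        show ?thesis unfolding has_field_derivative_def
          by (rule has_derivative_eq_rhs)
            (simp add: fun_eq_iff mult.assoc sum_distrib_left[symmetric] sum_axis_mult mult.commute[of "g b _"])
      qed
      then show "((\<lambda>r. F (u + r *\<^sub>R ?e) - F (u' + r *\<^sub>R ?e)) has_field_derivative g b (u + r *\<^sub>R ?e) - g b (u' + r *\<^sub>R ?e)) (at r within UNIV)"
        by (auto intro!: derivative_eq_intros)
      show "norm (g b (u + r *\<^sub>R ?e) - g b (u' + r *\<^sub>R ?e)) \<le> norm (u - u')"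
        using g[of b "u + r *\<^sub>R ?e" "u' + r *\<^sub>R ?e"] by simp
    qed auto
    then show ?thesis by simp
  qed
  define q where "q x r = (smoothed s F (x + r *\<^sub>R ?e) - smoothed s F (x + 0 *\<^sub>R ?e)) / r" for x r
  have lim: "(q x \<longlongrightarrow> smoothed_deriv s b F x) (at 0)" for x
  proof -
    show ?thesis
      using smoothed_has_derivative[OF F_meas growth s, of x ?e] by (simp add: DERIV_def q_def[abs_def] sum_axis_mult)
  qed
  \<comment> \<open>The bound on the quotients is uniform in \<open>r\<close>, hence survives the
    limit that defines the two derivatives.\<close>
  have "((\<lambda>r. \<bar>q x r - q x' r\<bar>) \<longlongrightarrow> \<bar>smoothed_deriv s b F x - smoothed_deriv s b F x'\<bar>) (at 0)"
    by (intro tendsto_intros lim)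
  moreover have "\<forall>\<^sub>F r in at 0. \<bar>q x r - q x' r\<bar> \<le> norm (x - x')"
  proof (rule eventually_at_topological[THEN iffD2], intro exI[of _ UNIV] conjI ballI impI)
    fix r :: real assume r: "r \<noteq> 0"
    have "\<bar>(smoothed s F (x + r *\<^sub>R ?e) - smoothed s F x) - (smoothed s F (x' + r *\<^sub>R ?e) - smoothed s F x')\<bar> =
      \<bar>\<integral>z. (F (x + r *\<^sub>R ?e + s *\<^sub>R z) - F (x + s *\<^sub>R z)) - (F (x' + r *\<^sub>R ?e + s *\<^sub>R z) - F (x' + s *\<^sub>R z)) \<partial>N\<bar>"
      unfolding smoothed_def using int by simp
    also have "\<dots> \<le> (\<integral>z. norm (x - x') * \<bar>r\<bar> \<partial>N)"
    proof (intro order_trans[OF integral_abs_bound] integral_mono)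
      show "\<bar>(F (x + r *\<^sub>R ?e + s *\<^sub>R z) - F (x + s *\<^sub>R z)) - (F (x' + r *\<^sub>R ?e + s *\<^sub>R z) - F (x' + s *\<^sub>R z))\<bar> \<le> norm (x - x') * \<bar>r\<bar>" for z
        using increment[of "x + s *\<^sub>R z" r "x' + s *\<^sub>R z"] by (simp add: algebra_simps)
    qed (use int in auto)
    also have "\<dots> = norm (x - x') * \<bar>r\<bar>" using prob_space by simp
    finally show "\<bar>q x r - q x' r\<bar> \<le> norm (x - x')"
      using r by (simp add: q_def diff_divide_distrib[symmetric] abs_divide pos_divide_le_eq)
  qed auto
  ultimately show ?thesis by (intro tendsto_upperbound) auto
qed

text \<open>Here \<open>\<Lambda> s = \<kappa> / s\<close>, so the factor
  \<open>cos \<theta>\<close> cancels. The integral of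
  \<open>\<kappa> * (sin \<theta>)\<^sup>2\<close> over the quarter turn is
  \<open>\<kappa> * pi / 4\<close>, which is the stated constant.\<close>

lemma normal_approximation_lipschitz_gradient:
  fixes h :: "real^'n \<Rightarrow> real"
  assumes sample: "iid_sample P X n V"
    and h: "\<And>x. (h has_derivative (\<lambda>y. \<Sum>a\<in>UNIV. y $ a * f a x)) (at x)"
    and lip: "\<And>a x x'. \<bar>f a x - f a x'\<bar> \<le> norm (x - x')"
    and pos: "\<And>b. 0 < W $ b $ b" and M: "\<And>b. sqrt (W $ b $ b) \<le> M"
  shows "\<bar>(\<integral>\<omega>. h (iid_sample.S X n \<omega>) \<partial>P) - (\<integral>z. h z \<partial>N)\<bar> \<le>
    sqrt (2 * pi) / (4 * sqrt (real n)) * M * iid_sample.bound_sum P X V"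
proof -
  define C where "C = (\<Sum>a\<in>UNIV. \<bar>\<bar>f a 0\<bar> + 1\<bar>)"
  \<comment> \<open>\<open>interpolation_bound\<close> takes one constant for the growth of both
    \<open>h\<close> and \<open>f\<close>.\<close>
  define C' where "C' = max C (\<bar>h 0\<bar> + real CARD('n) * C)"
  define \<kappa> where "\<kappa> = sqrt (2 / pi) * M"
  have C: "0 \<le> C" unfolding C_def by (rule sum_nonneg) simp
  have f1: "\<bar>f a x\<bar> \<le> C * (1 + norm x) ^ 1" for a x
    unfolding C_def by (rule uniform_growth_constant[where f=f, OF lipschitz_linear_growth[OF lip]])
  have f2: "\<bar>f a x\<bar> \<le> C * (1 + norm x) ^ 2" for a x
    by (rule order_trans[OF f1 mult_left_mono[OF _ C]]) (intro power_increasing; simp)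
  have h3: "\<bar>h x\<bar> \<le> (\<bar>h 0\<bar> + real CARD('n) * C) * (1 + norm x) ^ 3" for x
    using growth_of_gradient_growth[OF h f2, of x] by simp
  have "\<bar>(\<integral>\<omega>. h (iid_sample.S X n \<omega>) \<partial>P) - (\<integral>z. h z \<partial>N)\<bar> \<le>
    (\<kappa> * (pi / 2 - sin (pi / 2) * cos (pi / 2)) / 2 - \<kappa> * (0 - sin 0 * cos 0) / 2) / sqrt (real n) * iid_sample.bound_sum P X V"
  proof (rule interpolation_bound[where C=C' and \<Lambda>="\<lambda>s. \<kappa> / s" and \<psi>="\<lambda>\<theta>. \<kappa> * (\<theta> - sin \<theta> * cos \<theta>) / 2" and \<psi>'="\<lambda>\<theta>. \<kappa> * (sin \<theta>)\<^sup>2", OF sample h])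
    show "\<bar>h x\<bar> \<le> C' * (1 + norm x) ^ 3" for x
      by (rule order_trans[OF h3 mult_right_mono]) (auto simp: C'_def)
    show "f a \<in> borel_measurable borel" for a by (rule borel_measurable_lipschitz_real[OF lip])
    show "\<bar>f a x\<bar> \<le> C' * (1 + norm x) ^ 2" for a x
      by (rule order_trans[OF f2 mult_right_mono]) (auto simp: C'_def)
    show "\<bar>smoothed_deriv s b (f a) x - smoothed_deriv s b (f a) x'\<bar> \<le> \<kappa> / s * norm (x - x')" if "0 < s" for s a b x x'
      by (rule order_trans[OF lipschitz_smoothed_deriv[OF lip that pos]])
        (use that M in \<open>auto simp: \<kappa>_def intro!: mult_right_mono divide_right_mono mult_left_mono\<close>)
    show "((\<lambda>\<theta>. \<kappa> * (\<theta> - sin \<theta> * cos \<theta>) / 2) has_real_derivative \<kappa> * (sin \<theta>)\<^sup>2) (at \<theta>)" for \<theta>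
    proof -
      \<comment> \<open>The product rule gives one minus \<open>cos\<^sup>2 - sin\<^sup>2\<close>,
        which equals twice the squared sine.\<close>
      have "\<kappa> * (1 - (cos \<theta> * cos \<theta> - sin \<theta> * sin \<theta>)) / 2 = \<kappa> * (sin \<theta>)\<^sup>2"
        using sin_cos_squared_add[of \<theta>] by (simp add: power2_eq_square[symmetric] cos_squared_eq)
      then show ?thesis by (auto intro!: derivative_eq_intros)
    qed
  qed simp
  also have "(\<kappa> * (pi / 2 - sin (pi / 2) * cos (pi / 2)) / 2 - \<kappa> * (0 - sin 0 * cos 0) / 2) = sqrt (2 * pi) / 4 * M"
  proof -
    have "sqrt (2 / pi) * pi = sqrt (2 * pi)"
      by (simp add: real_sqrt_mult real_sqrt_divide field_simps)
    then show ?thesis by (simp add: \<kappa>_def)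
  qed
  finally show ?thesis by simp
qed

text \<open>Smoothing does not increase the Lipschitz constant of the second derivatives, so
  \<open>\<Lambda>\<close> is constantly one and \<open>(sin \<theta>) ^ 3 / 3\<close> is the
  antiderivative. The growth bounds climb from linear for \<open>g\<close> to quadratic for
  \<open>f\<close> and cubic for \<open>h\<close>.\<close>

lemma normal_approximation_lipschitz_hessian:
  fixes h :: "real^'n \<Rightarrow> real"
  assumes sample: "iid_sample P X n V"
    and h: "\<And>x. (h has_derivative (\<lambda>y. \<Sum>a\<in>UNIV. y $ a * f a x)) (at x)"
    and f: "\<And>a x. (f a has_derivative (\<lambda>y. \<Sum>b\<in>UNIV. y $ b * g a b x)) (at x)"
    and lip: "\<And>a b x x'. \<bar>g a b x - g a b x'\<bar> \<le> norm (x - x')"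
  shows "\<bar>(\<integral>\<omega>. h (iid_sample.S X n \<omega>) \<partial>P) - (\<integral>z. h z \<partial>N)\<bar> \<le>
    1 / (3 * sqrt (real n)) * iid_sample.bound_sum P X V"
proof -
  define A where "A a = (\<Sum>b\<in>UNIV. \<bar>\<bar>g a b 0\<bar> + 1\<bar>)" for a
  define C where "C = (\<Sum>a\<in>UNIV. \<bar>\<bar>f a 0\<bar> + real CARD('n) * A a\<bar>)"
  define C' where "C' = max C (\<bar>h 0\<bar> + real CARD('n) * C)"
  have g1: "\<bar>g a b x\<bar> \<le> A a * (1 + norm x) ^ 1" for a b x
    unfolding A_def by (rule uniform_growth_constant[where f="g a", OF lipschitz_linear_growth[OF lip]])
  have "\<bar>f a x\<bar> \<le> (\<bar>f a 0\<bar> + real CARD('n) * A a) * (1 + norm x) ^ (1 + 1)" for a x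
    by (rule growth_of_gradient_growth[OF f g1])
  then have f2: "\<bar>f a x\<bar> \<le> C * (1 + norm x) ^ 2" for a x
    unfolding C_def by (intro uniform_growth_constant[where f=f]) (simp add: numeral_2_eq_2)
  have h3: "\<bar>h x\<bar> \<le> (\<bar>h 0\<bar> + real CARD('n) * C) * (1 + norm x) ^ 3" for x
    using growth_of_gradient_growth[OF h f2, of x] by simp
  have "\<bar>(\<integral>\<omega>. h (iid_sample.S X n \<omega>) \<partial>P) - (\<integral>z. h z \<partial>N)\<bar> \<le>
    ((sin (pi / 2)) ^ 3 / 3 - (sin 0) ^ 3 / 3) / sqrt (real n) * iid_sample.bound_sum P X V"
  proof (rule interpolation_bound[where C=C' and \<Lambda>="\<lambda>s. 1" and \<psi>="\<lambda>\<theta>. (sin \<theta>) ^ 3 / 3" and \<psi>'="\<lambda>\<theta>. cos \<theta> * (sin \<theta>)\<^sup>2", OF sample h])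
    show "\<bar>h x\<bar> \<le> C' * (1 + norm x) ^ 3" for x
      by (rule order_trans[OF h3 mult_right_mono]) (auto simp: C'_def)
    show "f a \<in> borel_measurable borel" for a
      using f by (intro borel_measurable_continuous_onI) (meson continuous_at_imp_continuous_on has_derivative_continuous)
    show "\<bar>f a x\<bar> \<le> C' * (1 + norm x) ^ 2" for a x
      by (rule order_trans[OF f2 mult_right_mono]) (auto simp: C'_def)
    show "\<bar>smoothed_deriv s b (f a) x - smoothed_deriv s b (f a) x'\<bar> \<le> 1 * norm (x - x')" if "0 < s" for s a b x x'
      using lipschitz_smoothed_deriv_of_gradient[OF f lip quadratic_growth_le_exp[OF f2] that] by simp
    show "((\<lambda>\<theta>. (sin \<theta>) ^ 3 / 3) has_real_derivative cos \<theta> * (sin \<theta>)\<^sup>2) (at \<theta>)" for \<theta>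
      by (auto intro!: derivative_eq_intros)
  qed simp
  then show ?thesis by simp
qed

end

section \<open>Random matrices as vectors\<close>

text \<open>\<open>matrix_inv\<close> is a choice among two-sided inverses; for square matrices a
  one-sided inverse is two-sided, so the choice is forced.\<close>

lemma matrix_inv_unique:
  fixes A B :: "real^'n^'n"
  assumes "A ** B = mat 1"
  shows "matrix_inv A = B"
proof -
  have BA: "B ** A = mat 1" using assms matrix_left_right_inverse by blast
  have "A ** matrix_inv A = mat 1 \<and> matrix_inv A ** A = mat 1"
    unfolding matrix_inv_def using assms BA by (metis (mono_tags, lifting) someI_ex)
  then show ?thesis
    using BA by (metis matrix_mul_assoc matrix_mul_lid matrix_mul_rid)
qed

lemma symmetric_positive_definite_inverse:
  fixes A :: "real^'n^'n"
  assumes "symmetric_positive_definite A"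
  shows "A ** matrix_inv A = mat 1" "transpose (matrix_inv A) = matrix_inv A" "0 < matrix_inv A $ i $ i"
proof -
  have sym: "transpose A = A" and pos: "\<And>x. x \<noteq> 0 \<Longrightarrow> 0 < x \<bullet> (A *v x)"
    using assms by (auto simp: symmetric_positive_definite_def)
  have "inj ((*v) A)"
  proof (rule injI)
    fix x y assume "A *v x = A *v y"
    then have "(x - y) \<bullet> (A *v (x - y)) = 0" by (simp add: matrix_vector_mult_diff_distrib)
    then show "x = y" using pos[of "x - y"] by force
  qed
  then obtain B where "B ** A = mat 1"
    using matrix_left_invertible_injective by blast
  then have AB: "A ** B = mat 1" using matrix_left_right_inverse by blast
  then have inv: "matrix_inv A = B" by (rule matrix_inv_unique)
  show AI: "A ** matrix_inv A = mat 1" using AB inv by simp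
  have "transpose (matrix_inv A) ** A = mat 1"
    using arg_cong[OF AI, of transpose] by (simp add: matrix_transpose_mul sym)
  then have "A ** transpose (matrix_inv A) = mat 1" using matrix_left_right_inverse by blast
  then show "transpose (matrix_inv A) = matrix_inv A" by (metis matrix_inv_unique)
  \<comment> \<open>At the \<open>i\<close>-th column of the inverse the quadratic form of
    \<open>A\<close> takes the value \<open>x $ i\<close>, the diagonal entry in question.\<close>
  define x where "x = matrix_inv A *v axis i 1"
  have Ax: "A *v x = axis i 1" by (simp add: x_def matrix_vector_mul_assoc AI)
  then have "x \<noteq> 0" by auto
  then have "0 < x $ i" using pos[of x] Ax by (simp add: inner_axis)
  then show "0 < matrix_inv A $ i $ i"
    by (simp add: x_def matrix_vector_mult_def axis_def if_distrib cong: if_cong)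
qed

lemma sum_UNIV_prod:
  fixes f :: "'a::finite \<times> 'b::finite \<Rightarrow> 'c::comm_monoid_add"
  shows "(\<Sum>p\<in>UNIV. f p) = (\<Sum>i\<in>UNIV. \<Sum>j\<in>UNIV. f (i, j))"
  by (simp add: sum.cartesian_product flip: UNIV_Times_UNIV)

text \<open>The mixed-product property, which makes the Kronecker product of inverses the inverse of
  the Kronecker product.\<close>

lemma kronecker_matrix_mult:
  fixes A :: "real^'n^'m" and B :: "real^'l^'k" and A' :: "real^'p^'n" and B' :: "real^'q^'l"
  shows "kronecker A B ** kronecker A' B' = kronecker (A ** A') (B ** B')"
  unfolding vec_eq_iff
  by (auto simp: kronecker_def matrix_matrix_mult_def sum_UNIV_prod sum_product intro!: sum.cong)

lemma kronecker_mat_1: "kronecker (mat 1 :: real^'m^'m) (mat 1 :: real^'k^'k) = mat 1"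
  by (simp add: vec_eq_iff kronecker_def mat_def prod_eq_iff)

lemma transpose_kronecker: "transpose (kronecker A B) = kronecker (transpose A) (transpose B)"
  by (simp add: vec_eq_iff kronecker_def transpose_def)

text \<open>Reading a matrix row by row labels its entries by pairs (row, column), the index type of
  \<open>kronecker \<Psi> \<Sigma>\<close>. With \<open>row_unvec\<close> this is an isometry
  between the Frobenius and the Euclidean norm, so Lipschitz constants carry over.\<close>

abbreviation (input) row_vec :: "real^'d^'v \<Rightarrow> real^('v \<times> 'd)" where
  "row_vec A \<equiv> vectorize (transpose A)"

definition row_unvec :: "real^('v \<times> 'd) \<Rightarrow> real^'d^'v" where
  "row_unvec v = (\<chi> i j. v $ (i, j))"

lemma row_vec_nth: "row_vec A $ p = A $ fst p $ snd p"
  by (simp add: vectorize_def transpose_def)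

lemma row_unvec_vec [simp]: "row_unvec (row_vec A) = A"
  by (simp add: row_unvec_def row_vec_nth vec_eq_iff)

lemma linear_row_vec: "linear row_vec"
  by (rule linearI) (simp_all add: vec_eq_iff row_vec_nth)

lemma linear_row_unvec: "linear row_unvec"
  by (rule linearI) (simp_all add: vec_eq_iff row_unvec_def)

lemma row_vec_measurable [measurable]: "row_vec \<in> borel_measurable borel"
  by (intro borel_measurable_continuous_onI linear_continuous_on linear_linear[THEN iffD2] linear_row_vec)

lemma row_unvec_measurable [measurable]: "row_unvec \<in> borel_measurable borel"
  by (intro borel_measurable_continuous_onI linear_continuous_on linear_linear[THEN iffD2] linear_row_unvec)

lemma norm_row_unvec: "norm (row_unvec v) = norm v"
  by (simp add: norm_vec_def L2_set_def row_unvec_def sum_UNIV_prod sum_nonneg)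

lemma row_unvec_axis: "row_unvec (axis (i, j) 1) = axis i (axis j 1)"
  by (simp add: row_unvec_def axis_def vec_eq_iff)

lemma lipschitz_seminorm_le_1:
  assumes "lipschitz_seminorm g \<le> 1"
  shows "\<bar>g X - g Y\<bar> \<le> norm (X - Y)"
proof (cases "X = Y")
  case False
  then have "ereal (\<bar>g X - g Y\<bar> / frobenius_norm (X - Y)) \<le> lipschitz_seminorm g"
    unfolding lipschitz_seminorm_def by (intro SUP_upper2[of "(X, Y)"]) auto
  also note assms
  finally show ?thesis using False by (simp add: frobenius_norm_eq_norm one_ereal_def pos_divide_le_eq)
qed simp

text \<open>\<open>partial_deriv\<close> is defined through the choice operator
  \<open>deriv\<close>. Frechet differentiability is what pins its value down and assembles the
  partial derivatives into the gradient expected by the vector lemmas.\<close>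

lemma has_derivative_row_unvec:
  fixes h :: "real^'d^'v \<Rightarrow> real"
  assumes "\<And>X. h differentiable (at X)"
  shows "((\<lambda>v. h (row_unvec v)) has_derivative
    (\<lambda>y. \<Sum>p\<in>UNIV. y $ p * partial_deriv (fst p) (snd p) h (row_unvec x))) (at x)"
proof -
  obtain D where D: "(h has_derivative D) (at (row_unvec x))"
    using assms by (auto simp: differentiable_def)
  then have lin: "linear D" by (simp add: has_derivative_linear)
  \<comment> \<open>Composing with the coordinate line through the point turns the Frechet
    derivative into a real derivative, which determines \<open>deriv\<close>.\<close>
  have partial: "D (axis i (axis j 1)) = partial_deriv i j h (row_unvec x)" for i j
  proof -
    have "((\<lambda>t. row_unvec x + t *\<^sub>R axis i (axis j 1)) has_derivative (\<lambda>t. t *\<^sub>R axis i (axis j 1))) (at 0)"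
      by (auto intro!: derivative_eq_intros)
    moreover have "(h has_derivative D) (at (row_unvec x + 0 *\<^sub>R axis i (axis j 1)))" using D by simp
    ultimately have "((\<lambda>t. h (row_unvec x + t *\<^sub>R axis i (axis j 1))) has_derivative (\<lambda>t. D (t *\<^sub>R axis i (axis j 1)))) (at 0)"
      by (rule has_derivative_compose)
    then have "((\<lambda>t. h (row_unvec x + t *\<^sub>R axis i (axis j 1))) has_field_derivative D (axis i (axis j 1))) (at 0)"
      unfolding has_field_derivative_def
      by (rule has_derivative_eq_rhs) (simp add: fun_eq_iff linear_scale[OF lin])
    then show ?thesis unfolding partial_deriv_def by (rule DERIV_imp_deriv[symmetric])
  qed
  have "(row_unvec has_derivative row_unvec) (at x)"
    by (intro linear_imp_has_derivative linear_row_unvec)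
  from has_derivative_compose[OF this D]
  show ?thesis
  proof (rule has_derivative_eq_rhs, intro ext)
    fix y :: "real^('v \<times> 'd)"
    have "D (row_unvec y) = D (row_unvec (\<Sum>p\<in>UNIV. y $ p *\<^sub>R axis p 1))"
      using basis_expansion[of y] by (simp add: scalar_mult_eq_scaleR)
    also have "\<dots> = (\<Sum>p\<in>UNIV. y $ p * D (row_unvec (axis p 1)))"
      by (simp add: linear_sum[OF linear_row_unvec] linear_sum[OF lin] linear_scale[OF linear_row_unvec] linear_scale[OF lin])
    also have "\<dots> = (\<Sum>p\<in>UNIV. y $ p * partial_deriv (fst p) (snd p) h (row_unvec x))"
      by (intro sum.cong refl) (metis partial prod.collapse row_unvec_axis)
    finally show "D (row_unvec y) = \<dots>" .
  qed
qed

section \<open>Translation of the hypotheses on random matrices to vectors\<close>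

lemma integrable_vec:
  fixes f :: "'a \<Rightarrow> ('b::euclidean_space)^'n"
  assumes "\<And>i. integrable M (\<lambda>x. f x $ i)"
  shows "integrable M f"
proof -
  have "bounded_linear (axis i :: 'b \<Rightarrow> 'b^'n)" for i
    by (intro linear_linear[THEN iffD2] linearI) (auto simp: vec_eq_iff axis_def)
  then have "integrable M (\<lambda>x. \<Sum>i\<in>UNIV. axis i (f x $ i))"
    using assms by (intro Bochner_Integration.integrable_sum integrable_bounded_linear[where T="axis _"])
  moreover have "(\<Sum>i\<in>UNIV. axis i (f x $ i)) = f x" for x
    by (simp add: vec_eq_iff axis_def)
  ultimately show ?thesis by simp
qed

lemma integral_vec_nth:
  fixes f :: "'a \<Rightarrow> ('b::euclidean_space)^'n"
  assumes "integrable M f"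
  shows "(\<integral>x. f x $ i \<partial>M) = (\<integral>x. f x \<partial>M) $ i"
  by (rule integral_bounded_linear[OF bounded_linear_vec_nth assms])

text \<open>Yields first and second moments from third ones: the product is at most the square of
  the sum of moduli, and a square is at most 1 plus the cube.\<close>

lemma abs_mult_le_add_power3:
  fixes x y :: real
  shows "\<bar>x * y\<bar> \<le> 1 + (\<bar>x\<bar> + \<bar>y\<bar>) ^ 3"
proof -
  define m where "m = \<bar>x\<bar> + \<bar>y\<bar>"
  have "\<bar>x * y\<bar> \<le> m * m" unfolding abs_mult m_def by (intro mult_mono) auto
  also have "\<dots> \<le> 1 + m ^ 3"
  proof (cases "m \<le> 1")
    case True
    then have "m * m \<le> 1" by (intro mult_le_one) (auto simp: m_def)
    moreover have "0 \<le> m ^ 3" by (simp add: m_def)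
    ultimately show ?thesis by linarith
  next
    case False
    then have "m ^ 2 \<le> m ^ 3" by (intro power_increasing) auto
    then show ?thesis by (simp add: power2_eq_square)
  qed
  finally show ?thesis by (simp add: m_def)
qed

text \<open>Mean and covariance are given as Bochner integrals of matrices, which are zero by
  default for non-integrable functions. Integrability of entries and products is therefore first
  derived from the third moments, and only then are coordinates taken out of the integrals.\<close>

lemma iid_sample_row_vec:
  fixes P :: "'a measure" and X :: "nat \<Rightarrow> 'a \<Rightarrow> real^'d^'v" and V :: "real^('v \<times> 'd)^('v \<times> 'd)"
  assumes "prob_space P" and n: "1 \<le> n" and iid: "iid_vars P X {0..n}"
    and mean: "(\<integral>\<omega>. X 0 \<omega> \<partial>P) = 0"
    and cov: "(\<integral>\<omega>. (columnvector (row_vec (X 0 \<omega>)) :: real^1^('v \<times> 'd)) ** rowvector (row_vec (X 0 \<omega>)) \<partial>P) = V"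
    and moment: "\<And>i j. integrable P (\<lambda>\<omega>. \<bar>X 0 \<omega> $ i $ j\<bar> ^ 3)"
  shows "iid_sample P (\<lambda>k \<omega>. row_vec (X k \<omega>)) n V"
proof -
  interpret prob_space P by fact
  have indep: "indep_vars (\<lambda>_. borel) X {0..n}"
    and ident: "\<And>k l. k \<le> n \<Longrightarrow> l \<le> n \<Longrightarrow> distr P borel (X k) = distr P borel (X l)"
    using iid unfolding iid_vars_def by (blast, meson atLeastAtMost_iff le0)
  have X_meas: "X k \<in> borel_measurable P" if "k \<le> n" for k
    using indep that by (auto simp: indep_vars_def)
  have X0 [measurable]: "X 0 \<in> borel_measurable P" by (rule X_meas) simp
  have nth [measurable]: "(\<lambda>X::real^'d^'v. X $ i $ j) \<in> borel_measurable borel" for i j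
    by (intro borel_measurable_continuous_onI continuous_intros)
  have sum3: "integrable P (\<lambda>\<omega>. (1 + (\<Sum>p\<in>I. \<bar>X 0 \<omega> $ fst p $ snd p\<bar>)) ^ 3)" for I :: "('v \<times> 'd) set"
    by (rule integrable_one_plus_sum_power3) (auto intro: moment)
  have norm3: "integrable P (\<lambda>\<omega>. norm (row_vec (X 0 \<omega>)) ^ 3)"
  proof (rule Bochner_Integration.integrable_bound[OF sum3[of UNIV]])
    show "AE \<omega> in P. norm (norm (row_vec (X 0 \<omega>)) ^ 3) \<le> norm ((1 + (\<Sum>p\<in>UNIV. \<bar>X 0 \<omega> $ fst p $ snd p\<bar>)) ^ 3)"
    proof (rule AE_I2)
      fix \<omega>
      have "norm (row_vec (X 0 \<omega>)) \<le> 1 + (\<Sum>p\<in>UNIV. \<bar>X 0 \<omega> $ fst p $ snd p\<bar>)"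
        using norm_le_l1_cart[of "row_vec (X 0 \<omega>)"] by (simp add: row_vec_nth)
      then have "norm (row_vec (X 0 \<omega>)) ^ 3 \<le> (1 + (\<Sum>p\<in>UNIV. \<bar>X 0 \<omega> $ fst p $ snd p\<bar>)) ^ 3"
        by (intro power_mono) auto
      then show "norm (norm (row_vec (X 0 \<omega>)) ^ 3) \<le> norm ((1 + (\<Sum>p\<in>UNIV. \<bar>X 0 \<omega> $ fst p $ snd p\<bar>)) ^ 3)"
        by simp
    qed
  qed measurable
  have prod_int: "integrable P (\<lambda>\<omega>. X 0 \<omega> $ i $ j * X 0 \<omega> $ k $ l)" for i j k l
  proof (rule Bochner_Integration.integrable_bound)
    show "integrable P (\<lambda>\<omega>. 1 + (\<bar>X 0 \<omega> $ i $ j\<bar> + \<bar>X 0 \<omega> $ k $ l\<bar>) ^ 3)"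
      by (intro Bochner_Integration.integrable_add integrable_add_power3 moment) auto
    show "AE \<omega> in P. norm (X 0 \<omega> $ i $ j * X 0 \<omega> $ k $ l) \<le> norm (1 + (\<bar>X 0 \<omega> $ i $ j\<bar> + \<bar>X 0 \<omega> $ k $ l\<bar>) ^ 3)"
      unfolding real_norm_def by (intro AE_I2 order_trans[OF abs_mult_le_add_power3 abs_ge_self])
  qed measurable
  have X_int: "integrable P (\<lambda>\<omega>. X 0 \<omega> $ i $ j)" for i j
  proof (rule Bochner_Integration.integrable_bound)
    show "integrable P (\<lambda>\<omega>. 1 + (\<bar>X 0 \<omega> $ i $ j\<bar> + 1) ^ 3)"
      by (intro Bochner_Integration.integrable_add integrable_add_power3 moment) auto
    show "AE \<omega> in P. norm (X 0 \<omega> $ i $ j) \<le> norm (1 + (\<bar>X 0 \<omega> $ i $ j\<bar> + 1) ^ 3)"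
    proof (rule AE_I2)
      fix \<omega>
      show "norm (X 0 \<omega> $ i $ j) \<le> norm (1 + (\<bar>X 0 \<omega> $ i $ j\<bar> + 1) ^ 3)"
        using abs_mult_le_add_power3[of "X 0 \<omega> $ i $ j" 1] by simp
    qed
  qed measurable
  show ?thesis
  proof
    show "indep_vars (\<lambda>_. borel) (\<lambda>k \<omega>. row_vec (X k \<omega>)) {0..n}"
      by (rule indep_vars_compose2[OF indep]) measurable
    show "distr P borel (\<lambda>\<omega>. row_vec (X k \<omega>)) = distr P borel (\<lambda>\<omega>. row_vec (X 0 \<omega>))" if "k \<le> n" for k
    proof -
      have "distr P borel (\<lambda>\<omega>. row_vec (X k \<omega>)) = distr (distr P borel (X k)) borel row_vec" if "k \<le> n" for k
        using X_meas[OF that] by (subst distr_distr) (auto simp: comp_def)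
      then show ?thesis using that ident[of k 0] by simp
    qed
    show "(\<integral>\<omega>. row_vec (X 0 \<omega>) $ a \<partial>P) = 0" for a
    proof -
      have "integrable P (\<lambda>\<omega>. X 0 \<omega>)" by (intro integrable_vec X_int)
      then have "(\<integral>\<omega>. X 0 \<omega> $ fst a $ snd a \<partial>P) = (\<integral>\<omega>. X 0 \<omega> \<partial>P) $ fst a $ snd a"
        by (simp add: integral_vec_nth integrable_vec X_int)
      then show ?thesis by (simp add: row_vec_nth mean)
    qed
    let ?M = "\<lambda>\<omega>. (columnvector (row_vec (X 0 \<omega>)) :: real^1^('v \<times> 'd)) ** rowvector (row_vec (X 0 \<omega>))"
    have M: "?M \<omega> $ a $ b = X 0 \<omega> $ fst a $ snd a * X 0 \<omega> $ fst b $ snd b" for \<omega> a b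
      by (simp add: matrix_matrix_mult_def columnvector_def rowvector_def row_vec_nth)
    show "(\<integral>\<omega>. row_vec (X 0 \<omega>) $ a * row_vec (X 0 \<omega>) $ b \<partial>P) = V $ a $ b" for a b
    proof -
      \<comment> \<open>A matrix is a vector of rows, so integrability and the extraction of an
        entry go in two stages.\<close>
      have 1: "integrable P (\<lambda>\<omega>. ?M \<omega> $ a)" for a by (rule integrable_vec) (simp add: M prod_int)
      have 2: "integrable P ?M" by (rule integrable_vec[OF 1])
      have "(\<integral>\<omega>. ?M \<omega> $ a $ b \<partial>P) = V $ a $ b"
        by (simp only: integral_vec_nth[OF 1] integral_vec_nth[OF 2] cov)
      then show ?thesis by (simp add: M row_vec_nth)
    qed
  qed (use n norm3 in auto)
qed

lemma gaussian_measure_matrix_normal: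
  fixes Q :: "'b measure" and Z :: "'b \<Rightarrow> real^'d^'v" and V W :: "real^('v \<times> 'd)^('v \<times> 'd)"
  assumes "prob_space Q" and normal: "matrix_normal Q Z 0 V"
    and W: "V ** W = mat 1" "transpose W = W"
  shows "gaussian_measure (distr Q borel (\<lambda>\<omega>. row_vec (Z \<omega>))) V W (1 / sqrt ((2 * pi) ^ CARD('v \<times> 'd) * det V))"
    (is "gaussian_measure ?N V W ?c")
proof -
  interpret Q: prob_space Q by fact
  have meas: "(\<lambda>\<omega>. row_vec (Z \<omega>)) \<in> borel_measurable Q"
    using normal by (simp add: matrix_normal_def distributed_def)
  have "distr Q lborel (\<lambda>\<omega>. row_vec (Z \<omega>)) = density lborel (\<lambda>x. ennreal (mvn_density (row_vec 0) V x))"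
    using normal unfolding matrix_normal_def by (rule distributed_distr_eq_density)
  moreover have "distr Q lborel (\<lambda>\<omega>. row_vec (Z \<omega>)) = ?N"
    by (rule distr_cong) auto
  moreover have "mvn_density (row_vec 0) V x = ?c * exp (- (x \<bullet> (W *v x)) / 2)" for x
    unfolding mvn_density_def matrix_inv_unique[OF W(1)] by (simp add: linear_0[OF linear_row_vec])
  ultimately have N: "?N = density lborel (\<lambda>z. ennreal (?c * exp (- (z \<bullet> (W *v z)) / 2)))"
    by simp
  interpret N: prob_space ?N using meas by (rule Q.prob_space_distr)
  \<comment> \<open>The sign of the constant is read off the total mass: for a negative constant
    \<open>ennreal\<close> would truncate the density to zero, contradicting mass one.\<close>
  have "0 \<le> ?c"
  proof (rule ccontr)
    assume "\<not> 0 \<le> ?c"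
    then have "ennreal (?c * exp (- (z \<bullet> (W *v z)) / 2)) = 0" for z
      by (intro ennreal_neg mult_nonpos_nonneg) auto
    then have "emeasure ?N UNIV = 0"
      unfolding N by (subst emeasure_density) auto
    then show False using N.emeasure_space_1 by simp
  qed
  then show ?thesis by unfold_locales (use N W in auto)
qed


section \<open>Transfer of the vector bounds to the smooth Wasserstein distances\<close>

theorem proposition3:
  fixes P :: "'a measure" and Q :: "'b measure"
    and \<Psi> :: "real^'v^'v" and \<Sigma> :: "real^'d^'d"
    and n :: nat
    and X :: "nat \<Rightarrow> 'a \<Rightarrow> real^'d^'v"
    and S :: "'a \<Rightarrow> real^'d^'v"
    and Z :: "'b \<Rightarrow> real^'d^'v"
    and \<mu> \<gamma> :: "(real^'d^'v) measure"
  assumes "prob_space P" and "prob_space Q"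
    and "1 \<le> n"
    and "symmetric_positive_definite \<Psi>" and "symmetric_positive_definite \<Sigma>"
    and "iid_vars P X {0..n}"
    and "(\<integral>\<omega>. X 0 \<omega> \<partial>P) = 0"
    and "(\<integral>\<omega>. (columnvector (vectorize (transpose (X 0 \<omega>))) :: real^1^('v \<times> 'd))
               ** rowvector (vectorize (transpose (X 0 \<omega>))) \<partial>P) = kronecker \<Psi> \<Sigma>"
    and "\<And>i j. integrable P (\<lambda>\<omega>. \<bar>X 0 \<omega> $ i $ j\<bar> ^ 3)"
    and "S = (\<lambda>\<omega>. (1 / sqrt (real n)) *\<^sub>R (\<Sum>k=1..n. X k \<omega>))"
    and "matrix_normal Q Z 0 (kronecker \<Psi> \<Sigma>)"
    and "\<mu> = distr P borel S" and "\<gamma> = distr Q borel Z"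
  shows
    "smooth_wasserstein 3 \<mu> \<gamma>
       \<le> ereal (1 / (3 * sqrt (real n)) *
           (\<Sum>i1\<in>UNIV. \<Sum>i2\<in>UNIV. \<Sum>i3\<in>UNIV. \<Sum>j1\<in>UNIV. \<Sum>j2\<in>UNIV. \<Sum>j3\<in>UNIV.
              1 / 2 * (\<integral>\<omega>. \<bar>X 0 \<omega> $ i1 $ j1 * X 0 \<omega> $ i2 $ j2 * X 0 \<omega> $ i3 $ j3\<bar> \<partial>P)
              + \<bar>\<Psi> $ i1 $ i2 * \<Sigma> $ j1 $ j2\<bar> * (\<integral>\<omega>. \<bar>X 0 \<omega> $ i3 $ j3\<bar> \<partial>P)))
     \<and> smooth_wasserstein 2 \<mu> \<gamma>
       \<le> ereal (sqrt (2 * pi) / (4 * sqrt (real n)) *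
           (MAX (i, j)\<in>UNIV. sqrt (matrix_inv \<Psi> $ i $ i * matrix_inv \<Sigma> $ j $ j)) *
           (\<Sum>i1\<in>UNIV. \<Sum>i2\<in>UNIV. \<Sum>i3\<in>UNIV. \<Sum>j1\<in>UNIV. \<Sum>j2\<in>UNIV. \<Sum>j3\<in>UNIV.
              1 / 2 * (\<integral>\<omega>. \<bar>X 0 \<omega> $ i1 $ j1 * X 0 \<omega> $ i2 $ j2 * X 0 \<omega> $ i3 $ j3\<bar> \<partial>P)
              + \<bar>\<Psi> $ i1 $ i2 * \<Sigma> $ j1 $ j2\<bar> * (\<integral>\<omega>. \<bar>X 0 \<omega> $ i3 $ j3\<bar> \<partial>P)))"
    (is "_ \<le> ereal (_ * ?B) \<and> _ \<le> ereal (_ * ?M * ?B)")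
proof -
  define V where "V = kronecker \<Psi> \<Sigma>"
  define W where "W = kronecker (matrix_inv \<Psi>) (matrix_inv \<Sigma>)"
  define Y where "Y = (\<lambda>k \<omega>. row_vec (X k \<omega>))"
  define N where "N = distr Q borel (\<lambda>\<omega>. row_vec (Z \<omega>))"
  note \<Psi> = symmetric_positive_definite_inverse[OF assms(4)]
  note \<Sigma> = symmetric_positive_definite_inverse[OF assms(5)]
  have VW: "V ** W = mat 1" by (simp add: V_def W_def kronecker_matrix_mult \<Psi>(1) \<Sigma>(1) kronecker_mat_1)
  have W_sym: "transpose W = W" by (simp add: W_def transpose_kronecker \<Psi>(2) \<Sigma>(2))
  \<comment> \<open>The diagonal of the inverse covariance consists of the products under the root
    in the theorem, so the maximum there dominates every \<open>sqrt (W $ p $ p)\<close>.\<close>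
  have W_diag: "W $ p $ p = matrix_inv \<Psi> $ fst p $ fst p * matrix_inv \<Sigma> $ snd p $ snd p" for p
    by (simp add: W_def kronecker_def)
  have W_pos: "0 < W $ p $ p" for p unfolding W_diag by (intro mult_pos_pos \<Psi>(3) \<Sigma>(3))
  have W_le: "sqrt (W $ p $ p) \<le> ?M" for p
    unfolding W_diag by (intro Max_ge) (auto intro: image_eqI[where x=p] simp: case_prod_unfold)
  have sample: "iid_sample P Y n V"
    unfolding Y_def V_def using assms by (intro iid_sample_row_vec) auto
  have gauss: "gaussian_measure N V W (1 / sqrt ((2 * pi) ^ CARD('v \<times> 'd) * det V))"
    unfolding N_def using assms VW W_sym by (intro gaussian_measure_matrix_normal) (auto simp: V_def)
  interpret iid: iid_sample P Y n V by (rule sample)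
  interpret gaussian_measure N V W "1 / sqrt ((2 * pi) ^ CARD('v \<times> 'd) * det V)" by (rule gauss)
  \<comment> \<open>Splitting the pair indices gives the order i1 j1 i2 j2 i3 j3; three exchanges of
    neighbouring sums bring the row indices to the front.\<close>
  have B: "iid.bound_sum = ?B"
  proof -
    define F where "F i1 j1 i2 j2 i3 j3 = 1 / 2 * (\<integral>\<omega>. \<bar>X 0 \<omega> $ i1 $ j1 * X 0 \<omega> $ i2 $ j2 * X 0 \<omega> $ i3 $ j3\<bar> \<partial>P)
              + \<bar>\<Psi> $ i1 $ i2 * \<Sigma> $ j1 $ j2\<bar> * (\<integral>\<omega>. \<bar>X 0 \<omega> $ i3 $ j3\<bar> \<partial>P)" for i1 j1 i2 j2 i3 j3
    have "iid.bound_sum = (\<Sum>i1\<in>UNIV. \<Sum>j1\<in>UNIV. \<Sum>i2\<in>UNIV. \<Sum>j2\<in>UNIV. \<Sum>i3\<in>UNIV. \<Sum>j3\<in>UNIV. F i1 j1 i2 j2 i3 j3)"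
      unfolding iid.bound_sum_def by (simp add: sum_UNIV_prod F_def Y_def V_def kronecker_def row_vec_nth)
    also have "\<dots> = (\<Sum>i1\<in>UNIV. \<Sum>j1\<in>UNIV. \<Sum>i2\<in>UNIV. \<Sum>i3\<in>UNIV. \<Sum>j2\<in>UNIV. \<Sum>j3\<in>UNIV. F i1 j1 i2 j2 i3 j3)"
      by (intro sum.cong refl sum.swap)
    also have "\<dots> = (\<Sum>i1\<in>UNIV. \<Sum>i2\<in>UNIV. \<Sum>j1\<in>UNIV. \<Sum>i3\<in>UNIV. \<Sum>j2\<in>UNIV. \<Sum>j3\<in>UNIV. F i1 j1 i2 j2 i3 j3)"
      by (intro sum.cong refl sum.swap)
    also have "\<dots> = (\<Sum>i1\<in>UNIV. \<Sum>i2\<in>UNIV. \<Sum>i3\<in>UNIV. \<Sum>j1\<in>UNIV. \<Sum>j2\<in>UNIV. \<Sum>j3\<in>UNIV. F i1 j1 i2 j2 i3 j3)"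
      by (intro sum.cong refl sum.swap)
    finally show ?thesis by (simp only: F_def)
  qed
  have X_meas: "X k \<in> borel_measurable P" if "k \<le> n" for k
    using assms(6) that by (auto simp: iid_vars_def iid.indep_vars_def)
  have S_meas: "S \<in> borel_measurable P"
    unfolding assms(10) by (intro borel_measurable_scaleR borel_measurable_sum X_meas borel_measurable_const) auto
  have Z_vec: "(\<lambda>\<omega>. row_vec (Z \<omega>)) \<in> borel_measurable Q"
    using assms(11) by (simp add: matrix_normal_def distributed_def)
  have Z_meas: "Z \<in> borel_measurable Q"
    using measurable_compose[OF Z_vec row_unvec_measurable] by simp
  have S_eq: "row_unvec (iid.S \<omega>) = S \<omega>" for \<omega>
    unfolding iid.S_def
    by (simp add: Y_def assms(10) linear_scale[OF linear_row_unvec] linear_sum[OF linear_row_unvec])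
  have integrals: "(\<integral>X. h X \<partial>\<mu>) = (\<integral>\<omega>. h (row_unvec (iid.S \<omega>)) \<partial>P)" "(\<integral>X. h X \<partial>\<gamma>) = (\<integral>z. h (row_unvec z) \<partial>N)"
    if "\<And>X. h differentiable (at X)" for h :: "real^'d^'v \<Rightarrow> real"
  proof -
    have h: "h \<in> borel_measurable borel"
      using that by (intro borel_measurable_continuous_onI continuous_at_imp_continuous_on) (auto intro: differentiable_imp_continuous_within)
    show "(\<integral>X. h X \<partial>\<mu>) = (\<integral>\<omega>. h (row_unvec (iid.S \<omega>)) \<partial>P)"
      unfolding assms(12) using S_meas h by (simp add: integral_distr S_eq)
    show "(\<integral>X. h X \<partial>\<gamma>) = (\<integral>z. h (row_unvec z) \<partial>N)"
      unfolding assms(13) N_def using Z_meas Z_vec measurable_compose[OF row_unvec_measurable h]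
      by (simp add: integral_distr h)
  qed
  show ?thesis
  proof
    show "smooth_wasserstein 3 \<mu> \<gamma> \<le> ereal (1 / (3 * sqrt (real n)) * ?B)"
      unfolding smooth_wasserstein_def
    proof (rule SUP_least)
      fix h :: "real^'d^'v \<Rightarrow> real" assume h: "h \<in> smooth_test_functions 3"
      then have diff: "\<And>X. h differentiable (at X)" and diff2: "\<And>i j X. partial_deriv i j h differentiable (at X)"
        by (auto simp: smooth_test_functions_def numeral_2_eq_2)
      \<comment> \<open>\<open>foldr\<close> applies the last list entry first, so \<open>p\<close>
        is the inner derivative and \<open>q\<close> the outer one.\<close>
      have "lipschitz_seminorm (iterated_partial_deriv [q, p] h) \<le> 1" for p q
        using h by (simp add: smooth_test_functions_def)
      from lipschitz_seminorm_le_1[OF this]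
      have lip: "\<bar>partial_deriv (fst q) (snd q) (partial_deriv (fst p) (snd p) h) X -
          partial_deriv (fst q) (snd q) (partial_deriv (fst p) (snd p) h) X'\<bar> \<le> norm (X - X')" for p q X X'
        by (simp add: iterated_partial_deriv_def case_prod_unfold)
      have "\<bar>(\<integral>\<omega>. h (row_unvec (iid.S \<omega>)) \<partial>P) - (\<integral>z. h (row_unvec z) \<partial>N)\<bar> \<le> 1 / (3 * sqrt (real n)) * iid.bound_sum"
      proof (rule normal_approximation_lipschitz_hessian[OF sample has_derivative_row_unvec[OF diff] has_derivative_row_unvec[OF diff2]])
        show "\<bar>partial_deriv (fst b) (snd b) (partial_deriv (fst a) (snd a) h) (row_unvec x) -
          partial_deriv (fst b) (snd b) (partial_deriv (fst a) (snd a) h) (row_unvec x')\<bar> \<le> norm (x - x')" for a b x x'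
          using lip[of b a "row_unvec x" "row_unvec x'"] by (simp add: norm_row_unvec flip: linear_diff[OF linear_row_unvec])
      qed
      then show "ereal \<bar>(\<integral>X. h X \<partial>\<mu>) - (\<integral>X. h X \<partial>\<gamma>)\<bar> \<le> ereal (1 / (3 * sqrt (real n)) * ?B)"
        unfolding integrals[OF diff] B by simp
    qed
    show "smooth_wasserstein 2 \<mu> \<gamma> \<le> ereal (sqrt (2 * pi) / (4 * sqrt (real n)) * ?M * ?B)"
      unfolding smooth_wasserstein_def
    proof (rule SUP_least)
      fix h :: "real^'d^'v \<Rightarrow> real" assume h: "h \<in> smooth_test_functions 2"
      then have diff: "\<And>X. h differentiable (at X)"
        by (auto simp: smooth_test_functions_def)
      have "lipschitz_seminorm (iterated_partial_deriv [p] h) \<le> 1" for p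
        using h by (simp add: smooth_test_functions_def)
      from lipschitz_seminorm_le_1[OF this]
      have lip: "\<bar>partial_deriv (fst p) (snd p) h X - partial_deriv (fst p) (snd p) h X'\<bar> \<le> norm (X - X')" for p X X'
        by (simp add: iterated_partial_deriv_def case_prod_unfold)
      have "\<bar>(\<integral>\<omega>. h (row_unvec (iid.S \<omega>)) \<partial>P) - (\<integral>z. h (row_unvec z) \<partial>N)\<bar> \<le>
        sqrt (2 * pi) / (4 * sqrt (real n)) * ?M * iid.bound_sum"
      proof (rule normal_approximation_lipschitz_gradient[OF sample has_derivative_row_unvec[OF diff] _ W_pos W_le])
        \<comment> \<open>Linearity and isometry of \<open>row_unvec\<close> turn the matrix
          Lipschitz bound into the vector one with the same constant.\<close>
        show "\<bar>partial_deriv (fst a) (snd a) h (row_unvec x) - partial_deriv (fst a) (snd a) h (row_unvec x')\<bar> \<le> norm (x - x')" for a x x'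
          using lip[of a "row_unvec x" "row_unvec x'"] by (simp add: norm_row_unvec flip: linear_diff[OF linear_row_unvec])
      qed
      then show "ereal \<bar>(\<integral>X. h X \<partial>\<mu>) - (\<integral>X. h X \<partial>\<gamma>)\<bar> \<le> ereal (sqrt (2 * pi) / (4 * sqrt (real n)) * ?M * ?B)"
        unfolding integrals[OF diff] B by simp
    qed
  qed
qed

end
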